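(* Let $n,k_r,k_c,\ell$ be integers with $0\le \ell\le k_r\le k_c\le n$ and $n\ge 3k_c-1$. For each $s=0,1,\dots,k_r$ let $\mathcal{M}_s$ be the $(k_r-s+1)\times(k_c-s+1)$ integer matrix, with rows indexed by $s\le i\le k_r$ and columns indexed by $s\le j\le k_c$, with entries $$\mathcal{M}_s(i,j)=\binom{j-s}{i-s}\sum_{v=0}^{i}(-1)^{i+v}\binom{i}{v}\binom{k_r-v}{\ell-v}\binom{n-k_r-j+v}{k_c-\ell-j+v},$$ and let $\Delta(\mathcal{M}_s)$ be the multiset of diagonal entries of a diagonal form of $\mathcal{M}_s$. Then the subset intersection matrix $\mathcal{A}_{n,k_r,k_c,\ell}$ has a diagonal form whose multiset of diagonal entries is $$\bigcup_{s=0}^{k_r}\Delta(\mathcal{M}_s)^{\binom{n}{s}-2\binom{n}{s-1}+\binom{n}{s-2}},$$ where the exponent means that each element of $\Delta(\mathcal{M}_s)$ (counted with its own multiplicity) is included with the indicated multiplicity.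
   Context: Binomial convention: $\binom{a}{b}=0$ whenever $b<0$ or $a<b$. The matrix $\mathcal{A}_{n,k_r,k_c,\ell}$ has rows indexed by the $k_r$-element subsets and columns indexed by the $k_c$-element subsets of $\{1,\dots,n\}$, with $(A,B)$ entry $1$ if $|A\cap B|=\ell$ and $0$ otherwise. A unimodular matrix is a square integer matrix with an integer inverse. A diagonal form of a (not necessarily square) integer matrix $M$ is a matrix $D$ of the same dimensions as $M$, with $(i,j)$-entry $0$ unless $i=j$, such that $EMF=D$ for some unimodular matrices $E,F$; its diagonal entries are the entries in positions $(i,i)$, so an $a\times b$ matrix has $\min(a,b)$ of them. *)

theory Defs
  imports "Jordan_Normal_Form.Matrix" "HOL-Library.Multiset"
begin

text \<open>The binomial coefficient of two integers, with value 0 if \<open>b < 0\<close> or \<open>a < b\<close>.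
  In particular it vanishes for all negative \<open>a\<close>, unlike \<open>gbinomial\<close>.\<close>

definition ibinom :: "int \<Rightarrow> int \<Rightarrow> int" where
  "ibinom a b = (if b < 0 \<or> a < b then 0 else int (nat a choose nat b))"

definition k_subsets :: "nat \<Rightarrow> nat \<Rightarrow> nat set set" where
  "k_subsets n k = {A. A \<subseteq> {1..n} \<and> card A = k}"

text \<open>The indexing of rows and columns by subsets is made explicit by lists \<open>rs\<close> and \<open>cs\<close> in
  which every row label and every column label, respectively, occurs exactly once.\<close>

definition enumerates :: "'a list \<Rightarrow> 'a set \<Rightarrow> bool" where
  "enumerates xs S \<longleftrightarrow> distinct xs \<and> set xs = S"

definition intersection_mat :: "nat set list \<Rightarrow> nat set list \<Rightarrow> nat \<Rightarrow> int mat" where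
  "intersection_mat rs cs l =
     mat (length rs) (length cs) (\<lambda>(i, j). if card (rs ! i \<inter> cs ! j) = l then 1 else 0)"

definition diagonal_form :: "int mat \<Rightarrow> int mat \<Rightarrow> bool" where
  "diagonal_form M D \<longleftrightarrow>
     D \<in> carrier_mat (dim_row M) (dim_col M) \<and> diagonal_mat D \<and>
     (\<exists>E F. E \<in> carrier_mat (dim_row M) (dim_row M) \<and> invertible_mat E \<and>
            F \<in> carrier_mat (dim_col M) (dim_col M) \<and> invertible_mat F \<and>
            E * M * F = D)"

text \<open>The library function \<^const>\<open>diag_mat\<close> reads one entry per row and is not meant for
  matrices with more rows than columns.\<close>

definition diag_entries :: "'a mat \<Rightarrow> 'a multiset" where
  "diag_entries D = {# D $$ (i, i). i \<in># mset_set {..<min (dim_row D) (dim_col D)} #}"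

definition M_entry :: "nat \<Rightarrow> nat \<Rightarrow> nat \<Rightarrow> nat \<Rightarrow> nat \<Rightarrow> nat \<Rightarrow> nat \<Rightarrow> int" where
  "M_entry n kr kc l s i j =
     ibinom (int j - int s) (int i - int s) *
     (\<Sum>v = 0..i. (-1) ^ (i + v) * ibinom (int i) (int v)
        * ibinom (int kr - int v) (int l - int v)
        * ibinom (int n - int kr - int j + int v) (int kc - int l - int j + int v))"

text \<open>Rows \<open>s \<le> i \<le> kr\<close> and columns \<open>s \<le> j \<le> kc\<close> are shifted to start at 0.\<close>

definition M_mat :: "nat \<Rightarrow> nat \<Rightarrow> nat \<Rightarrow> nat \<Rightarrow> nat \<Rightarrow> int mat" where
  "M_mat n kr kc l s =
     mat (kr - s + 1) (kc - s + 1) (\<lambda>(a, b). M_entry n kr kc l s (s + a) (s + b))"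

definition multiplicity_exponent :: "nat \<Rightarrow> nat \<Rightarrow> int" where
  "multiplicity_exponent n s =
     ibinom (int n) (int s) - 2 * ibinom (int n) (int s - 1) + ibinom (int n) (int s - 2)"

text \<open>In the relevant range the exponent is nonnegative, so converting it to a natural number
  loses nothing.\<close>

lemma multiplicity_exponent_nonneg:
  assumes "3 * int s - 1 \<le> int n" "s \<le> n"
  shows "multiplicity_exponent n s \<ge> 0"
proof -
  consider "s = 0" | "s = 1" | t where "s = Suc (Suc t)"
    by (metis One_nat_def not0_implies_Suc)
  then show ?thesis
  proof cases
    case 1
    then show ?thesis by (simp add: multiplicity_exponent_def ibinom_def)
  next
    case 2
    then show ?thesis using assms by (simp add: multiplicity_exponent_def ibinom_def)
  next
    case 3
    define a b c where "a = int (n choose t)" and "b = int (n choose Suc t)"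
      and "c = int (n choose Suc (Suc t))"
    define m where "m = int n - int t"
    have nt: "Suc (Suc t) \<le> n" using assms 3 by simp
    have step: "int (Suc k) * int (n choose Suc k) = (int n - int k) * int (n choose k)"
      if "k \<le> n" for k
      using binomial_absorb_comp[of n k] binomial_absorption[of k n] that
      by (metis of_nat_diff of_nat_mult)
    have ab: "(int t + 1) * b = m * a"
      using step[of t] nt by (simp add: a_def b_def m_def algebra_simps)
    have bc: "(int t + 2) * c = (m - 1) * b"
      using step[of "Suc t"] nt by (simp add: b_def c_def m_def algebra_simps)
    have e: "multiplicity_exponent n s = c - 2 * b + a"
    proof -
      have "nat (1 + int t) = Suc t" "nat (2 + int t) = Suc (Suc t)" by simp_all
      then show ?thesis using nt 3
        by (simp add: multiplicity_exponent_def ibinom_def a_def b_def c_def)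
    qed
    have "(int t + 2) * (int t + 1) * (c - 2 * b + a)
        = (int t + 1) * ((int t + 2) * c) - 2 * (int t + 2) * ((int t + 1) * b)
          + (int t + 2) * (int t + 1) * a"
      by (simp add: algebra_simps)
    also have "\<dots> = (m - 1) * ((int t + 1) * b) - 2 * (int t + 2) * ((int t + 1) * b)
          + (int t + 2) * (int t + 1) * a"
      unfolding bc by (simp add: algebra_simps)
    also have "\<dots> = a * (m * (m - 1) - 2 * (int t + 2) * m + (int t + 2) * (int t + 1))"
      unfolding ab by (simp add: algebra_simps)
    finally have eq: "(int t + 2) * (int t + 1) * (c - 2 * b + a)
        = a * (m * (m - 1) - 2 * (int t + 2) * m + (int t + 2) * (int t + 1))" .
    define u where "u = m - (2 * int t + 5)"
    have u: "u \<ge> 0" using assms 3 by (simp add: u_def m_def)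
    have "m * (m - 1) - 2 * (int t + 2) * m + (int t + 2) * (int t + 1)
        = u * u + u * (2 * int t + 5) + (int t + 2) * (int t + 1)"
      by (simp add: u_def algebra_simps)
    also have "\<dots> \<ge> 0" using u by simp
    finally have "0 \<le> (int t + 2) * (int t + 1) * (c - 2 * b + a)"
      unfolding eq by (simp add: a_def)
    moreover have "0 < (int t + 2) * (int t + 1)" by simp
    ultimately have "c - 2 * b + a \<ge> 0"
      using zero_le_mult_iff[of "(int t + 2) * (int t + 1)" "c - 2 * b + a"] by linarith
    then show ?thesis using e by simp
  qed
qed

end

theory Submission
  imports Defs
begin

text \<open>For a subset \<open>S\<close> of \<open>{1..n}\<close> let \<open>S\<close> also denote the 0/1 vector on the \<open>k\<close>-subsets that marks those
  containing \<open>S\<close>. For \<open>j\<close>-subsets \<open>T\<close>, the number of \<open>kc\<close>-subsets that contain \<open>T\<close> and meet a given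
  \<open>kr\<close>-subset \<open>A\<close> in \<open>l\<close> points depends only on \<open>j\<close> and \<open>card (A \<inter> T)\<close>. Expanding it in binomial
  coefficients of \<open>card (A \<inter> T)\<close> shows that the intersection matrix maps the vector \<open>T\<close> to an
  integral combination of the vectors \<open>T'\<close> with \<open>T' \<subseteq> T\<close>, where the coefficient depends only on
  the two cardinalities (\<open>intersection_incl_product\<close>).

  To exploit this, the vectors \<open>T\<close> are restricted to a family that is a basis over the integers and
  closed under taking subsets. The ballot sets with at most \<open>k\<close> elements are such a family
  (\<open>unimodular_ballot_k_subsets\<close>), so in these bases the intersection matrix becomes a
  block matrix whose \<open>(i, j)\<close> block is a scalar times the inclusion matrix between ballot sets of
  sizes \<open>i\<close> and \<open>j\<close>.

  It remains to diagonalise all these inclusion matrices simultaneously. This is possible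
  because the complex of ballot sets itself has a basis of the same kind: there are ballot sets, the
  generators, such that for every \<open>i\<close> with \<open>3 * i \<le> n + 1\<close> the matrix of inclusions of the
  generators with at most \<open>i\<close> elements in the ballot sets of size \<open>i\<close> is unimodular
  (\<open>ballot_generators\<close>). A generator \<open>S\<close> of size \<open>s\<close> contributes one basis vector in every degree
  \<open>i \<ge> s\<close>, and multiplication by the inclusion matrix between sizes \<open>i\<close> and \<open>j\<close> relates the vectors
  in these two degrees by the factor \<open>(j - s) choose (i - s)\<close>, the number of sets of size \<open>i\<close>
  between \<open>S\<close> and a set of size \<open>j\<close>. Hence the intersection matrix is equivalent to the
  direct sum of one copy of \<open>M_mat n kr kc l s\<close> for every generator of size \<open>s \<le> kr\<close> and some zero
  columns (\<open>chain_incl_product\<close>), and the blocks are diagonalised separately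
  (\<open>chain_blocks_equiv\<close>). For \<open>0 < 2 * k \<le> n\<close> there are \<open>(n choose k) - (n choose (k - 1))\<close> ballot
  sets of size \<open>k\<close>, and the number of generators is the difference of consecutive numbers of ballot sets, which is the
  exponent in the theorem.

  Both basis statements are proved by induction on \<open>n\<close>, separating the sets that contain the last
  point from the others. The two ways of pairing these parts are \<open>unimodular_incl_deletion_link\<close> and
  \<open>unimodular_incl_exchange\<close>.\<close>

section \<open>Unimodular matrices indexed by finite sets\<close>

definition right_inverse_on :: "'a set \<Rightarrow> 'b set \<Rightarrow> ('a \<Rightarrow> 'b \<Rightarrow> int) \<Rightarrow> ('b \<Rightarrow> 'a \<Rightarrow> int) \<Rightarrow> bool" where
  "right_inverse_on A B M N \<longleftrightarrow>
     (\<forall>a\<in>A. \<forall>a'\<in>A. (\<Sum>b\<in>B. M a b * N b a') = of_bool (a = a'))"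

text \<open>Rows and columns are indexed by arbitrary finite sets, because all block decompositions below
  cut out rows and columns by set-theoretic conditions. That the matrix is square is a consequence,
  see \<open>unimodular_on_card\<close>.\<close>

definition unimodular_on :: "'a set \<Rightarrow> 'b set \<Rightarrow> ('a \<Rightarrow> 'b \<Rightarrow> int) \<Rightarrow> bool" where
  "unimodular_on A B M \<longleftrightarrow> finite A \<and> finite B \<and>
     (\<exists>N. right_inverse_on A B M N \<and> right_inverse_on B A N M)"

lemma right_inverse_onD:
  "\<lbrakk>right_inverse_on A B M N; a \<in> A; a' \<in> A\<rbrakk> \<Longrightarrow> (\<Sum>b\<in>B. M a b * N b a') = of_bool (a = a')"
  by (simp add: right_inverse_on_def)

lemma right_inverse_on_transpose:
  assumes "right_inverse_on A B M N"
  shows "right_inverse_on A B (\<lambda>a b. N b a) (\<lambda>b a. M a b)"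
  unfolding right_inverse_on_def
proof (intro ballI)
  fix a a' assume "a \<in> A" "a' \<in> A"
  then have "(\<Sum>b\<in>B. M a' b * N b a) = of_bool (a' = a)"
    using assms by (intro right_inverse_onD)
  then show "(\<Sum>b\<in>B. N b a * M a' b) = of_bool (a = a')"
    by (simp add: mult.commute eq_commute[of a'])
qed

lemma right_inverse_on_cong:
  assumes "right_inverse_on A B M N"
    and "\<And>a b. a \<in> A \<Longrightarrow> b \<in> B \<Longrightarrow> M a b = M' a b"
    and "\<And>a b. a \<in> A \<Longrightarrow> b \<in> B \<Longrightarrow> N b a = N' b a"
  shows "right_inverse_on A B M' N'"
  unfolding right_inverse_on_def
proof (intro ballI)
  fix a a' assume a: "a \<in> A" "a' \<in> A"
  then have "(\<Sum>b\<in>B. M' a b * N' b a') = (\<Sum>b\<in>B. M a b * N b a')"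
    by (intro sum.cong) (simp_all add: assms(2,3))
  then show "(\<Sum>b\<in>B. M' a b * N' b a') = of_bool (a = a')"
    using right_inverse_onD[OF assms(1) a] by simp
qed

lemma unimodular_onI:
  "\<lbrakk>finite A; finite B; right_inverse_on A B M N; right_inverse_on B A N M\<rbrakk> \<Longrightarrow> unimodular_on A B M"
  by (auto simp: unimodular_on_def)

lemma unimodular_onE:
  assumes "unimodular_on A B M"
  obtains N where "finite A" "finite B" "right_inverse_on A B M N" "right_inverse_on B A N M"
    "unimodular_on B A N"
  using assms by (auto simp: unimodular_on_def)

lemma sum_mult_assoc:
  fixes M L :: "_ \<Rightarrow> int"
  shows "(\<Sum>c\<in>C. (\<Sum>b\<in>B. M b * N b c) * L c) = (\<Sum>b\<in>B. M b * (\<Sum>c\<in>C. N b c * L c))"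
  by (simp add: sum_distrib_left sum_distrib_right mult.assoc sum.swap[of _ C B])

lemma sum_of_bool_mult:
  fixes f :: "_ \<Rightarrow> int"
  assumes "finite B" "b \<in> B"
  shows "(\<Sum>x\<in>B. of_bool (b = x) * f x) = f b" "(\<Sum>x\<in>B. of_bool (x = b) * f x) = f b"
    "(\<Sum>x\<in>B. f x * of_bool (b = x)) = f b" "(\<Sum>x\<in>B. f x * of_bool (x = b)) = f b"
proof -
  have "(\<Sum>x\<in>B. of_bool (b = x) * f x) = (\<Sum>x\<in>B. if b = x then f x else 0)"
    by (rule sum.cong) auto
  then show *: "(\<Sum>x\<in>B. of_bool (b = x) * f x) = f b"
    using assms by simp
  show "(\<Sum>x\<in>B. of_bool (x = b) * f x) = f b" "(\<Sum>x\<in>B. f x * of_bool (b = x)) = f b"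
    "(\<Sum>x\<in>B. f x * of_bool (x = b)) = f b"
    using * by (simp_all add: eq_commute mult.commute)
qed

lemma unimodular_on_cong:
  assumes "unimodular_on A B M" "\<And>a b. a \<in> A \<Longrightarrow> b \<in> B \<Longrightarrow> M a b = M' a b"
  shows "unimodular_on A B M'"
proof -
  obtain N where N: "finite A" "finite B" "right_inverse_on A B M N" "right_inverse_on B A N M"
    using assms(1) by (rule unimodular_onE)
  show ?thesis
    by (rule unimodular_onI[OF N(1,2) right_inverse_on_cong[OF N(3)] right_inverse_on_cong[OF N(4)]])
       (simp_all add: assms(2))
qed

text \<open>Both cardinalities are the trace of the identity matrix of the corresponding size, and the
  traces of \<open>M N\<close> and \<open>N M\<close> agree.\<close>

lemma unimodular_on_card:
  assumes "unimodular_on A B M"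
  shows "card A = card B"
proof -
  obtain N where N: "finite A" "finite B" "right_inverse_on A B M N" "right_inverse_on B A N M"
    using assms by (rule unimodular_onE)
  have "int (card A) = (\<Sum>a\<in>A. \<Sum>b\<in>B. M a b * N b a)"
    by (simp add: right_inverse_onD[OF N(3)])
  also have "\<dots> = (\<Sum>b\<in>B. \<Sum>a\<in>A. N b a * M a b)"
    by (subst sum.swap) (simp add: mult.commute)
  also have "\<dots> = int (card B)"
    by (simp add: right_inverse_onD[OF N(4)])
  finally show ?thesis by simp
qed

lemma unimodular_on_transpose:
  assumes "unimodular_on A B M"
  shows "unimodular_on B A (\<lambda>b a. M a b)"
proof -
  obtain N where N: "finite A" "finite B" "right_inverse_on A B M N" "right_inverse_on B A N M"
    using assms by (rule unimodular_onE)
  show ?thesis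
    by (rule unimodular_onI[OF N(2,1) right_inverse_on_transpose[OF N(4)]
          right_inverse_on_transpose[OF N(3)]])
qed

lemma right_inverse_on_mult:
  assumes "finite B" "right_inverse_on A B M M'" "right_inverse_on B C N N'"
  shows "right_inverse_on A C (\<lambda>a c. \<Sum>b\<in>B. M a b * N b c) (\<lambda>c a. \<Sum>b\<in>B. N' c b * M' b a)"
  unfolding right_inverse_on_def
proof (intro ballI)
  fix a a' assume a: "a \<in> A" "a' \<in> A"
  have "(\<Sum>c\<in>C. (\<Sum>b\<in>B. M a b * N b c) * (\<Sum>b'\<in>B. N' c b' * M' b' a'))
      = (\<Sum>b\<in>B. M a b * (\<Sum>c\<in>C. N b c * (\<Sum>b'\<in>B. N' c b' * M' b' a')))"
    by (rule sum_mult_assoc)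
  also have "\<dots> = (\<Sum>b\<in>B. M a b * (\<Sum>b'\<in>B. (\<Sum>c\<in>C. N b c * N' c b') * M' b' a'))"
    by (simp add: sum_mult_assoc)
  also have "\<dots> = (\<Sum>b\<in>B. M a b * M' b a')"
    using assms(1) by (simp add: right_inverse_onD[OF assms(3)] sum_of_bool_mult)
  also have "\<dots> = of_bool (a = a')" using a by (simp add: right_inverse_onD[OF assms(2)])
  finally show "(\<Sum>c\<in>C. (\<Sum>b\<in>B. M a b * N b c) * (\<Sum>b'\<in>B. N' c b' * M' b' a'))
    = of_bool (a = a')" .
qed

lemma unimodular_on_mult:
  assumes "unimodular_on A B M" "unimodular_on B C N"
  shows "unimodular_on A C (\<lambda>a c. \<Sum>b\<in>B. M a b * N b c)"
proof -
  obtain M' where M': "finite A" "finite B" "right_inverse_on A B M M'" "right_inverse_on B A M' M"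
    using assms(1) by (rule unimodular_onE)
  obtain N' where N': "finite B" "finite C" "right_inverse_on B C N N'" "right_inverse_on C B N' N"
    using assms(2) by (rule unimodular_onE)
  show ?thesis
    by (rule unimodular_onI[OF M'(1) N'(2) right_inverse_on_mult[OF M'(2,3) N'(3)]
          right_inverse_on_mult[OF N'(1,4) M'(4)]])
qed

lemma right_inverse_on_relabel:
  assumes "right_inverse_on A B M N" "bij_betw f A' A" "bij_betw g B' B"
  shows "right_inverse_on A' B' (\<lambda>a b. M (f a) (g b)) (\<lambda>b a. N (g b) (f a))"
  unfolding right_inverse_on_def
proof (intro ballI)
  fix a a' assume a: "a \<in> A'" "a' \<in> A'"
  have "(\<Sum>b\<in>B'. M (f a) (g b) * N (g b) (f a')) = (\<Sum>b\<in>B. M (f a) b * N b (f a'))"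
    by (rule sum.reindex_bij_betw[OF assms(3)])
  also have "\<dots> = of_bool (f a = f a')"
    using a assms(2) by (intro right_inverse_onD[OF assms(1)]) (auto simp: bij_betw_def)
  also have "f a = f a' \<longleftrightarrow> a = a'"
    using a assms(2) by (auto simp: bij_betw_def inj_on_def)
  finally show "(\<Sum>b\<in>B'. M (f a) (g b) * N (g b) (f a')) = of_bool (a = a')" .
qed

lemma unimodular_on_relabel:
  assumes "unimodular_on A B M" "bij_betw f A' A" "bij_betw g B' B"
  shows "unimodular_on A' B' (\<lambda>a b. M (f a) (g b))"
proof -
  obtain N where N: "finite A" "finite B" "right_inverse_on A B M N" "right_inverse_on B A N M"
    using assms(1) by (rule unimodular_onE)
  have "finite A'" "finite B'"
    using N(1,2) assms(2,3) by (simp_all add: bij_betw_finite)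
  then show ?thesis
    by (rule unimodular_onI[OF _ _ right_inverse_on_relabel[OF N(3) assms(2,3)]
          right_inverse_on_relabel[OF N(4) assms(3,2)]])
qed

lemma right_inverse_on_block_triangular:
  fixes M :: "'a \<Rightarrow> 'b \<Rightarrow> int"
  assumes fin: "finite A1" "finite A2" "finite B1" "finite B2"
    and disj: "A1 \<inter> A2 = {}" "B1 \<inter> B2 = {}"
    and inv1: "right_inverse_on A1 B1 M N1" and inv2: "right_inverse_on A2 B2 M N2"
    and zero: "\<And>a b. a \<in> A2 \<Longrightarrow> b \<in> B1 \<Longrightarrow> M a b = 0"
  shows "right_inverse_on (A1 \<union> A2) (B1 \<union> B2) M
    (\<lambda>b a. if b \<in> B1
       then if a \<in> A1 then N1 b a else - (\<Sum>a1\<in>A1. N1 b a1 * (\<Sum>b2\<in>B2. M a1 b2 * N2 b2 a))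
       else if a \<in> A1 then 0 else N2 b a)"
    (is "right_inverse_on _ _ M ?N")
  unfolding right_inverse_on_def
proof (intro ballI)
  fix a a' assume a: "a \<in> A1 \<union> A2" "a' \<in> A1 \<union> A2"
  have nB: "b \<notin> B1" if "b \<in> B2" for b using that disj by blast
  have nA: "a \<notin> A1" if "a \<in> A2" for a using that disj by blast
  have split: "(\<Sum>b\<in>B1 \<union> B2. M a b * ?N b a')
      = (\<Sum>b\<in>B1. M a b * ?N b a') + (\<Sum>b\<in>B2. M a b * ?N b a')"
    by (rule sum.union_disjoint) (use fin disj in auto)
  show "(\<Sum>b\<in>B1 \<union> B2. M a b * ?N b a') = of_bool (a = a')"
  proof (cases "a' \<in> A1")
    case a'1: True
    have "(\<Sum>b\<in>B2. M a b * ?N b a') = 0"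
      using a'1 nB by (intro sum.neutral) auto
    moreover have "(\<Sum>b\<in>B1. M a b * ?N b a') = of_bool (a = a')"
    proof (cases "a \<in> A1")
      case True
      then show ?thesis using a'1 by (simp add: right_inverse_onD[OF inv1])
    next
      case False
      then have "a \<in> A2" "a \<noteq> a'" using a a'1 by auto
      then show ?thesis by (simp add: zero)
    qed
    ultimately show ?thesis by (simp only: split)
  next
    case a'2: False
    then have a'2': "a' \<in> A2" using a by blast
    have second: "(\<Sum>b\<in>B2. M a b * ?N b a') = (\<Sum>b\<in>B2. M a b * N2 b a')"
      using a'2 nB by (intro sum.cong) auto
    have first: "(\<Sum>b\<in>B1. M a b * ?N b a')
       = - (\<Sum>b\<in>B1. M a b * (\<Sum>a1\<in>A1. N1 b a1 * (\<Sum>b2\<in>B2. M a1 b2 * N2 b2 a')))"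
      using a'2 by (simp add: sum_negf)
    show ?thesis
    proof (cases "a \<in> A1")
      case True
      have "(\<Sum>b\<in>B1. M a b * (\<Sum>a1\<in>A1. N1 b a1 * (\<Sum>b2\<in>B2. M a1 b2 * N2 b2 a')))
        = (\<Sum>a1\<in>A1. (\<Sum>b\<in>B1. M a b * N1 b a1) * (\<Sum>b2\<in>B2. M a1 b2 * N2 b2 a'))"
        by (simp only: sum_mult_assoc)
      also have "\<dots> = (\<Sum>b2\<in>B2. M a b2 * N2 b2 a')"
        using True fin by (simp add: right_inverse_onD[OF inv1] sum_of_bool_mult)
      finally show ?thesis unfolding split first second using True a'2 by auto
    next
      case False
      then have "a \<in> A2" using a by blast
      then show ?thesis unfolding split first second
        using a'2' by (simp add: zero right_inverse_onD[OF inv2])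
    qed
  qed
qed

text \<open>The inverse of a block triangular matrix with diagonal blocks \<open>M\<^sub>1\<close>, \<open>M\<^sub>2\<close> and corner \<open>C\<close> is
  block triangular with corner \<open>- M\<^sub>1\<^sup>-\<^sup>1 C M\<^sub>2\<^sup>-\<^sup>1\<close>. That it is also a left inverse is the same
  statement for the transposed matrix, with the roles of the two blocks exchanged.\<close>

lemma unimodular_on_block_triangular:
  assumes u1: "unimodular_on A1 B1 M" and u2: "unimodular_on A2 B2 M"
    and disj: "A1 \<inter> A2 = {}" "B1 \<inter> B2 = {}"
    and zero: "\<And>a b. a \<in> A2 \<Longrightarrow> b \<in> B1 \<Longrightarrow> M a b = 0"
  shows "unimodular_on (A1 \<union> A2) (B1 \<union> B2) M"
proof -
  obtain N1 where N1: "finite A1" "finite B1" "right_inverse_on A1 B1 M N1"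
    "right_inverse_on B1 A1 N1 M"
    using u1 by (rule unimodular_onE)
  obtain N2 where N2: "finite A2" "finite B2" "right_inverse_on A2 B2 M N2"
    "right_inverse_on B2 A2 N2 M"
    using u2 by (rule unimodular_onE)
  let ?N = "\<lambda>b a. if b \<in> B1
       then if a \<in> A1 then N1 b a else - (\<Sum>a1\<in>A1. N1 b a1 * (\<Sum>b2\<in>B2. M a1 b2 * N2 b2 a))
       else if a \<in> A1 then 0 else N2 b a"
  let ?N' = "\<lambda>a b. if a \<in> A2
       then if b \<in> B2 then N2 b a else - (\<Sum>b2\<in>B2. N2 b2 a * (\<Sum>a1\<in>A1. M a1 b2 * N1 b a1))
       else if b \<in> B2 then 0 else N1 b a"
  have right: "right_inverse_on (A1 \<union> A2) (B1 \<union> B2) M ?N"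
    by (rule right_inverse_on_block_triangular) (use N1 N2 disj zero in auto)
  have left: "right_inverse_on (B2 \<union> B1) (A2 \<union> A1) (\<lambda>b a. M a b) ?N'"
    by (rule right_inverse_on_block_triangular)
       (use N1 N2 disj zero right_inverse_on_transpose[OF N1(4)] right_inverse_on_transpose[OF N2(4)]
         in auto)
  have "?N' a b = ?N b a" if "a \<in> A1 \<union> A2" "b \<in> B1 \<union> B2" for a b
  proof -
    have "(\<Sum>b2\<in>B2. N2 b2 a * (\<Sum>a1\<in>A1. M a1 b2 * N1 b a1))
        = (\<Sum>a1\<in>A1. N1 b a1 * (\<Sum>b2\<in>B2. M a1 b2 * N2 b2 a))"
      by (simp add: sum_distrib_left sum.swap[of _ B2 A1] ac_simps)
    then show ?thesis using that disj by auto
  qed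
  then have "right_inverse_on (B1 \<union> B2) (A1 \<union> A2) ?N M"
    using right_inverse_on_transpose[OF left] unfolding Un_commute[of B2] Un_commute[of A2]
    by (elim right_inverse_on_cong) simp_all
  then show ?thesis
    using right N1(1,2) N2(1,2) by (intro unimodular_onI) auto
qed

lemma right_inverse_on_block_diagonal:
  assumes "finite B"
    and "\<And>i. right_inverse_on {a\<in>A. p a = i} {b\<in>B. q b = i} M (N i)"
    and zero: "\<And>a b. a \<in> A \<Longrightarrow> b \<in> B \<Longrightarrow> p a \<noteq> q b \<Longrightarrow> M a b = 0"
  shows "right_inverse_on A B M (\<lambda>b a. if q b = p a then N (p a) b a else 0)"
  unfolding right_inverse_on_def
proof (intro ballI)
  fix a a' assume a: "a \<in> A" "a' \<in> A"
  have "(\<Sum>b\<in>B. M a b * (if q b = p a' then N (p a') b a' else 0))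
      = (\<Sum>b\<in>{b\<in>B. q b = p a}. M a b * (if q b = p a' then N (p a') b a' else 0))"
  proof (rule sum.mono_neutral_right)
    show "\<forall>b\<in>B - {b\<in>B. q b = p a}. M a b * (if q b = p a' then N (p a') b a' else 0) = 0"
      using zero[OF a(1)] by force
  qed (use assms(1) in auto)
  also have "\<dots> = of_bool (a = a')"
  proof (cases "p a = p a'")
    case True
    have "(\<Sum>b\<in>{b\<in>B. q b = p a}. M a b * (if q b = p a' then N (p a') b a' else 0))
      = (\<Sum>b\<in>{b\<in>B. q b = p a}. M a b * N (p a) b a')"
      using True by (intro sum.cong) auto
    then show ?thesis using right_inverse_onD[OF assms(2)[of "p a"], of a a'] a True by simp
  next
    case False
    then show ?thesis by auto
  qed
  finally show "(\<Sum>b\<in>B. M a b * (if q b = p a' then N (p a') b a' else 0)) = of_bool (a = a')" .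
qed

text \<open>The blocks are the fibres of the labellings \<open>p\<close> of the rows and \<open>q\<close> of the columns.\<close>

lemma unimodular_on_block_diagonal:
  assumes fin: "finite A" "finite B"
    and blocks: "\<And>i. unimodular_on {a\<in>A. p a = i} {b\<in>B. q b = i} M"
    and zero: "\<And>a b. a \<in> A \<Longrightarrow> b \<in> B \<Longrightarrow> p a \<noteq> q b \<Longrightarrow> M a b = 0"
  shows "unimodular_on A B M"
proof -
  have "\<forall>i. \<exists>N. right_inverse_on {a\<in>A. p a = i} {b\<in>B. q b = i} M N \<and>
      right_inverse_on {b\<in>B. q b = i} {a\<in>A. p a = i} N M"
    using blocks by (auto simp: unimodular_on_def)
  from choice[OF this] obtain N
    where N: "\<And>i. right_inverse_on {a\<in>A. p a = i} {b\<in>B. q b = i} M (N i)"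
      "\<And>i. right_inverse_on {b\<in>B. q b = i} {a\<in>A. p a = i} (N i) M"
    by auto
  let ?N = "\<lambda>b a. if q b = p a then N (p a) b a else 0"
  have right: "right_inverse_on A B M ?N"
    by (rule right_inverse_on_block_diagonal[OF fin(2) N(1) zero])
  have "right_inverse_on B A (\<lambda>b a. M a b) (\<lambda>a b. if p a = q b then N (q b) b a else 0)"
  proof (rule right_inverse_on_block_diagonal[OF fin(1)])
    show "right_inverse_on {b\<in>B. q b = i} {a\<in>A. p a = i} (\<lambda>b a. M a b) (\<lambda>a b. N i b a)" for i
      by (rule right_inverse_on_transpose[OF N(2)])
  qed (use zero in auto)
  from right_inverse_on_transpose[OF this] have "right_inverse_on B A ?N M"
    by (rule right_inverse_on_cong) auto
  then show ?thesis by (rule unimodular_onI[OF fin right])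
qed

lemma unimodular_on_identity:
  assumes "finite A" "\<And>a b. a \<in> A \<Longrightarrow> b \<in> A \<Longrightarrow> M a b = of_bool (a = b)"
  shows "unimodular_on A A M"
proof -
  have "right_inverse_on A A (\<lambda>a b. of_bool (a = b)) (\<lambda>a b. of_bool (a = b))"
    by (simp add: right_inverse_on_def sum_of_bool_mult(1)[OF assms(1)])
  from right_inverse_on_cong[OF this] show ?thesis
    by (intro unimodular_onI[where N = M]) (simp_all add: assms)
qed

lemma unimodular_on_uminus:
  assumes "unimodular_on A B M"
  shows "unimodular_on A B (\<lambda>a b. - M a b)"
proof -
  obtain N where N: "finite A" "finite B" "right_inverse_on A B M N" "right_inverse_on B A N M"
    using assms by (rule unimodular_onE)
  then show ?thesis
    by (intro unimodular_onI[where N = "\<lambda>b a. - N b a"]) (simp_all add: right_inverse_on_def)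
qed

lemma unimodular_on_empty: "unimodular_on {} {} M"
  by (rule unimodular_onI) (simp_all add: right_inverse_on_def)

section \<open>Inclusion matrices and the deletion of a point\<close>

definition incl :: "'a set \<Rightarrow> 'a set \<Rightarrow> int" where
  "incl S T = of_bool (S \<subseteq> T)"

lemma bij_betw_insert_image:
  assumes "\<And>S. S \<in> F \<Longrightarrow> x \<notin> S"
  shows "bij_betw (\<lambda>S. S - {x}) (insert x ` F) F"
proof (rule bij_betw_byWitness[where f' = "insert x"])
  show "(\<lambda>S. S - {x}) ` insert x ` F \<subseteq> F"
    using assms by (auto simp: image_iff)
qed (use assms in auto)

lemma unimodular_incl_link:
  assumes "unimodular_on G R incl" "\<And>S. S \<in> G \<Longrightarrow> x \<notin> S" "\<And>T. T \<in> R \<Longrightarrow> x \<notin> T"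
  shows "unimodular_on (insert x ` G) (insert x ` R) incl"
  using unimodular_on_relabel[OF assms(1) bij_betw_insert_image[OF assms(2)]
      bij_betw_insert_image[OF assms(3)]]
  by (rule unimodular_on_cong) (auto simp: incl_def)

text \<open>No set containing \<open>x\<close> is included in a set avoiding \<open>x\<close>, so separating the sets that contain
  \<open>x\<close> from the others makes the inclusion matrix block triangular.\<close>

lemma unimodular_incl_deletion_link:
  assumes "unimodular_on G R1 incl" "unimodular_on G' R2 incl"
    and fresh: "\<And>S. S \<in> G \<union> G' \<union> R1 \<union> R2 \<Longrightarrow> x \<notin> S"
  shows "unimodular_on (G \<union> insert x ` G') (R1 \<union> insert x ` R2) incl"
proof (rule unimodular_on_block_triangular)
  show "unimodular_on (insert x ` G') (insert x ` R2) incl"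
    by (rule unimodular_incl_link[OF assms(2)]) (use fresh in auto)
qed (use assms fresh in \<open>auto simp: incl_def\<close>)

text \<open>Subtracting row \<open>S\<close> from row \<open>insert x S\<close> leaves zeros in the columns that contain \<open>x\<close> and the
  negative of row \<open>S\<close> in the other columns. So the rows in \<open>G\<close> can be matched with the columns that
  contain \<open>x\<close>, and the rows that contain \<open>x\<close> with the columns that do not: the opposite of the
  pairing in \<open>unimodular_incl_deletion_link\<close>. The inclusion \<open>G' \<subseteq> G\<close> makes the row operation
  available.\<close>

lemma unimodular_incl_exchange:
  assumes G: "unimodular_on G R2 incl" and G': "unimodular_on G' R1 incl" and sub: "G' \<subseteq> G"
    and fresh: "\<And>S. S \<in> G \<union> R1 \<union> R2 \<Longrightarrow> x \<notin> S"
  shows "unimodular_on (G \<union> insert x ` G') (R1 \<union> insert x ` R2) incl"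
proof -
  let ?A = "insert x ` G' \<union> G"
  let ?B = "insert x ` R2 \<union> R1"
  define P :: "_ \<Rightarrow> _ \<Rightarrow> int" where
    "P = (\<lambda>S S'. of_bool (S = S') + of_bool (x \<in> S \<and> S - {x} = S'))"
  define M :: "_ \<Rightarrow> _ \<Rightarrow> int" where
    "M = (\<lambda>S T. if x \<in> S then incl S T - incl (S - {x}) T else incl S T)"
  have fresh': "\<And>S. S \<in> G' \<Longrightarrow> x \<notin> S" "\<And>S. S \<in> G \<Longrightarrow> x \<notin> S"
      "\<And>S. S \<in> R1 \<Longrightarrow> x \<notin> S" "\<And>S. S \<in> R2 \<Longrightarrow> x \<notin> S"
    using fresh sub by auto
  have fin: "finite G" "finite G'"
    using G G' by (auto simp: unimodular_on_def)
  have "unimodular_on ?A ?A P"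
  proof (rule unimodular_on_block_triangular)
    show "unimodular_on (insert x ` G') (insert x ` G') P"
      by (rule unimodular_on_identity) (use fin in \<open>auto simp: P_def\<close>)
    show "unimodular_on G G P"
      by (rule unimodular_on_identity) (use fin fresh in \<open>auto simp: P_def\<close>)
  qed (use fresh in \<open>auto simp: P_def\<close>)
  moreover have "unimodular_on (G \<union> insert x ` G') ?B M"
  proof (rule unimodular_on_block_triangular)
    have "unimodular_on G (insert x ` R2) (\<lambda>S T. incl S (T - {x}))"
      by (rule unimodular_on_relabel[OF G, where f = "\<lambda>S. S"])
         (use fresh' in \<open>auto intro: bij_betw_insert_image bij_betw_id[unfolded id_def]\<close>)
    then show "unimodular_on G (insert x ` R2) M"
      by (rule unimodular_on_cong) (use fresh' in \<open>auto simp: M_def incl_def\<close>)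
    have "unimodular_on (insert x ` G') R1 (\<lambda>S T. - incl (S - {x}) T)"
      by (rule unimodular_on_relabel[OF unimodular_on_uminus[OF G'], where g = "\<lambda>S. S"])
         (use fresh' in \<open>auto intro: bij_betw_insert_image bij_betw_id[unfolded id_def]\<close>)
    then show "unimodular_on (insert x ` G') R1 M"
      by (rule unimodular_on_cong) (use fresh' in \<open>auto simp: M_def incl_def\<close>)
  qed (use fresh' in \<open>auto simp: M_def incl_def\<close>)
  ultimately have "unimodular_on ?A ?B (\<lambda>S T. \<Sum>S'\<in>?A. P S S' * M S' T)"
    by (intro unimodular_on_mult) (simp_all add: Un_commute)
  moreover have "(\<Sum>S'\<in>?A. P S S' * M S' T) = incl S T" if S: "S \<in> ?A" for S T
  proof (cases "x \<in> S")
    case True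
    then have "S - {x} \<in> ?A" using S fresh' sub by auto
    then have "(\<Sum>S'\<in>?A. P S S' * M S' T) = M S T + M (S - {x}) T"
      using True S fin by (simp add: P_def distrib_right sum.distrib sum_of_bool_mult)
    then show ?thesis using True by (simp add: M_def)
  next
    case False
    then have "(\<Sum>S'\<in>?A. P S S' * M S' T) = M S T"
      using S fin by (simp add: P_def sum_of_bool_mult)
    then show ?thesis using False by (simp add: M_def)
  qed
  ultimately have "unimodular_on ?A ?B incl"
    by (rule unimodular_on_cong)
  then show ?thesis by (simp only: Un_commute)
qed

lemma unimodular_incl_singleton:
  "unimodular_on {{}} {T} incl"
  by (rule unimodular_onI[where N = "\<lambda>_ _. 1"]) (auto simp: right_inverse_on_def incl_def)

section \<open>Ballot sets\<close>

text \<open>These are the second rows of standard Young tableaux with at most two rows: every initial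
  segment contains at least as many points outside \<open>T\<close> as inside.\<close>

definition ballot :: "nat \<Rightarrow> nat \<Rightarrow> nat set set" where
  "ballot n k = {T. T \<subseteq> {1..n} \<and> card T = k \<and> (\<forall>m\<le>n. 2 * card (T \<inter> {1..m}) \<le> m)}"

lemma ballotD: "T \<in> ballot n k \<Longrightarrow> finite T \<and> T \<subseteq> {1..n} \<and> card T = k"
  by (auto simp: ballot_def intro: finite_subset)

lemma finite_ballot [simp]: "finite (ballot n k)"
  by (rule finite_subset[of _ "Pow {1..n}"]) (auto simp: ballot_def)

lemma finite_k_subsets [simp]: "finite (k_subsets n k)"
  by (rule finite_subset[of _ "Pow {1..n}"]) (auto simp: k_subsets_def)

lemma ballot_0 [simp]: "ballot n 0 = {{}}"
  by (auto simp: ballot_def dest: finite_subset)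

lemma k_subsets_0 [simp]: "k_subsets n 0 = {{}}"
  by (auto simp: k_subsets_def dest: finite_subset)

lemma ballot_subset:
  assumes "S \<subseteq> T" "T \<in> ballot n k"
  shows "S \<in> ballot n (card S)"
proof -
  have "2 * card (S \<inter> {1..m}) \<le> m" if "m \<le> n" for m
  proof -
    have "card (S \<inter> {1..m}) \<le> card (T \<inter> {1..m})"
      using assms(1) by (intro card_mono) auto
    moreover have "2 * card (T \<inter> {1..m}) \<le> m"
      using assms(2) that by (simp add: ballot_def)
    ultimately show ?thesis by linarith
  qed
  moreover have "S \<subseteq> {1..n}" using assms ballotD by blast
  ultimately show ?thesis by (simp add: ballot_def)
qed

lemma ballot_empty:
  assumes "n < 2 * k"
  shows "ballot n k = {}"
proof -
  have "2 * k \<le> n" if "T \<in> ballot n k" for T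
  proof -
    have "T \<inter> {1..n} = T" using ballotD[OF that] by blast
    then show ?thesis using that by (auto simp: ballot_def dest: spec[of _ n])
  qed
  then show ?thesis using assms by fastforce
qed

lemma insert_Suc_cases:
  assumes "T \<subseteq> {1..Suc n}" "card T = Suc k"
  shows "T \<subseteq> {1..n} \<or> (\<exists>S. T = insert (Suc n) S \<and> S \<subseteq> {1..n} \<and> card S = k)"
proof (cases "Suc n \<in> T")
  case True
  have "finite T" using assms(1) finite_subset by blast
  with True assms show ?thesis
    by (intro disjI2 exI[of _ "T - {Suc n}"]) (auto simp: le_Suc_eq subset_iff)
next
  case False
  then show ?thesis using assms(1) by (auto simp: le_Suc_eq subset_iff)
qed

lemma card_insert_Suc: "S \<subseteq> {1..n} \<Longrightarrow> card (insert (Suc n) S) = Suc (card S)"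
  by (subst card_insert_disjoint) (auto dest: finite_subset)

lemma k_subsets_Suc:
  "k_subsets (Suc n) (Suc k) = k_subsets n (Suc k) \<union> insert (Suc n) ` k_subsets n k"
proof (intro Set.equalityI subsetI)
  fix T assume "T \<in> k_subsets (Suc n) (Suc k)"
  then show "T \<in> k_subsets n (Suc k) \<union> insert (Suc n) ` k_subsets n k"
    using insert_Suc_cases[of T n k] by (auto simp: k_subsets_def)
next
  fix T assume "T \<in> k_subsets n (Suc k) \<union> insert (Suc n) ` k_subsets n k"
  then show "T \<in> k_subsets (Suc n) (Suc k)"
    by (force simp: k_subsets_def card_insert_Suc)
qed

text \<open>The size bound is exactly the ballot condition at the last point.\<close>

lemma ballot_Suc:
  assumes "2 * Suc k \<le> Suc n"
  shows "ballot (Suc n) (Suc k) = ballot n (Suc k) \<union> insert (Suc n) ` ballot n k"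
proof (intro Set.equalityI subsetI)
  fix T assume T: "T \<in> ballot (Suc n) (Suc k)"
  then consider "T \<subseteq> {1..n}" | S where "T = insert (Suc n) S" "S \<subseteq> {1..n}" "card S = k"
    using insert_Suc_cases[of T n k] ballotD[OF T] by blast
  then show "T \<in> ballot n (Suc k) \<union> insert (Suc n) ` ballot n k"
  proof cases
    case 1
    then show ?thesis using T by (auto simp: ballot_def)
  next
    case 2
    have "2 * card (S \<inter> {1..m}) \<le> m" if "m \<le> n" for m
    proof -
      have "S \<inter> {1..m} = T \<inter> {1..m}" using 2(1) that by auto
      then show ?thesis using T that by (simp add: ballot_def)
    qed
    then have "S \<in> ballot n k" using 2 by (simp add: ballot_def)
    then show ?thesis using 2(1) by blast
  qed
next
  fix T assume "T \<in> ballot n (Suc k) \<union> insert (Suc n) ` ballot n k"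
  then consider "T \<in> ballot n (Suc k)" | S where "T = insert (Suc n) S" "S \<in> ballot n k"
    by blast
  then show "T \<in> ballot (Suc n) (Suc k)"
  proof cases
    case 1
    have "T \<subseteq> {1..Suc n}" "card T = Suc k" using ballotD[OF 1] by auto
    moreover from this have "T \<inter> {1..Suc n} = T" by blast
    ultimately show ?thesis using 1 assms by (simp add: ballot_def le_Suc_eq all_conj_distrib)
  next
    case 2
    have S: "S \<subseteq> {1..n}" "card S = k" using ballotD[OF 2(2)] by auto
    have "2 * card (T \<inter> {1..m}) \<le> m" if "m \<le> n" for m
    proof -
      have "T \<inter> {1..m} = S \<inter> {1..m}" using 2(1) that by auto
      then show ?thesis using 2(2) that by (simp add: ballot_def)
    qed
    moreover have "T \<subseteq> {1..Suc n}" "card T = Suc k" using 2(1) S card_insert_Suc by auto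
    moreover from this have "T \<inter> {1..Suc n} = T" by blast
    ultimately show ?thesis
      using assms by (auto simp: ballot_def le_Suc_eq)
  qed
qed

lemma UN_atMost_Suc_insert:
  assumes "G' 0 = G 0" "\<And>j. j \<le> i \<Longrightarrow> G' (Suc j) = G (Suc j) \<union> insert x ` G j"
  shows "(\<Union>j\<le>Suc i. G' j) = (\<Union>j\<le>Suc i. G j) \<union> insert x ` (\<Union>j\<le>i. G j)"
proof -
  have "(\<Union>j\<le>Suc i. G' j) = G' 0 \<union> (\<Union>j\<le>i. G' (Suc j))"
    unfolding atMost_Suc_eq_insert_0 by auto
  also have "\<dots> = G 0 \<union> (\<Union>j\<le>i. G (Suc j)) \<union> insert x ` (\<Union>j\<le>i. G j)"
    using assms by auto
  also have "G 0 \<union> (\<Union>j\<le>i. G (Suc j)) = (\<Union>j\<le>Suc i. G j)"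
    unfolding atMost_Suc_eq_insert_0 by auto
  finally show ?thesis .
qed

text \<open>Deleting the last point reduces \<open>(n + 1, k)\<close> to \<open>(n, k)\<close> and \<open>(n, k - 1)\<close>. Below the middle
  layer, the rows and columns avoiding the point are matched with each other. Above it, the
  size bound is \<open>n - k\<close> instead of \<open>k\<close>, and this bound is larger for \<open>(n, k - 1)\<close> than for
  \<open>(n, k)\<close>. The rows avoiding the point, which are the more numerous ones, then have to be matched
  with the columns that contain it.\<close>

theorem unimodular_ballot_k_subsets:
  assumes "k \<le> n"
  shows "unimodular_on (\<Union>j\<le>min k (n - k). ballot n j) (k_subsets n k) incl"
  using assms
proof (induction n arbitrary: k)
  case 0
  then show ?case by (simp add: unimodular_incl_singleton)
next
  case (Suc n)
  consider "k = 0" | "k = Suc n" | k' where "k = Suc k'" "k' < n"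
    using Suc.prems by (cases k) (auto simp: le_less)
  then show ?case
  proof cases
    case 1
    then show ?thesis by (simp add: unimodular_incl_singleton)
  next
    case 2
    have "k_subsets (Suc n) k = {{1..Suc n}}"
      using 2 by (auto simp: k_subsets_def dest: card_subset_eq[rotated])
    then show ?thesis using 2 by (simp add: unimodular_incl_singleton)
  next
    case 3
    have fresh: "Suc n \<notin> S"
      if "S \<in> (\<Union>j\<le>i. ballot n j) \<union> k_subsets n l \<union> k_subsets n m" for S i l m
      using that by (auto simp: ballot_def k_subsets_def)
    have UN: "(\<Union>j\<le>Suc i. ballot (Suc n) j)
        = (\<Union>j\<le>Suc i. ballot n j) \<union> insert (Suc n) ` (\<Union>j\<le>i. ballot n j)"
      if "2 * Suc i \<le> Suc n" for i
      by (rule UN_atMost_Suc_insert) (use that in \<open>auto intro!: ballot_Suc\<close>)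
    note IH = Suc.IH[of k] Suc.IH[of k']
    show ?thesis
    proof (cases "2 * k \<le> Suc n")
      case True
      have "(\<Union>j\<le>min k (n - k). ballot n j) = (\<Union>j\<le>Suc k'. ballot n j)"
      proof (cases "2 * k \<le> n")
        case True
        then have "min k (n - k) = k" by linarith
        then show ?thesis using 3 by simp
      next
        case False
        then have "min k (n - k) = k'" "n < 2 * Suc k'"
          using \<open>2 * k \<le> Suc n\<close> 3 by auto
        then show ?thesis using ballot_empty[of n "Suc k'"] by (simp add: atMost_Suc)
      qed
      moreover have "min k' (n - k') = k'" "min k (Suc n - k) = Suc k'"
        using True 3 by auto
      ultimately have "unimodular_on (\<Union>j\<le>Suc k'. ballot n j) (k_subsets n (Suc k')) incl"
          "unimodular_on (\<Union>j\<le>k'. ballot n j) (k_subsets n k') incl"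
        using IH 3 by simp_all
      then have "unimodular_on (\<Union>j\<le>Suc k'. ballot (Suc n) j) (k_subsets (Suc n) (Suc k')) incl"
        unfolding UN[OF True[unfolded 3(1)]] k_subsets_Suc
        by (rule unimodular_incl_deletion_link) (use fresh in blast)
      then show ?thesis using \<open>min k (Suc n - k) = Suc k'\<close> 3(1) by simp
    next
      case False
      define i where "i = n - k"
      have i: "min k (n - k) = i" "min k' (n - k') = Suc i" "min k (Suc n - k) = Suc i"
          "2 * Suc i \<le> Suc n"
        using False 3 by (auto simp: i_def)
      then have "unimodular_on (\<Union>j\<le>Suc i. ballot n j) (k_subsets n k') incl"
          "unimodular_on (\<Union>j\<le>i. ballot n j) (k_subsets n (Suc k')) incl"
        using IH 3 by simp_all
      then have "unimodular_on (\<Union>j\<le>Suc i. ballot (Suc n) j) (k_subsets (Suc n) (Suc k')) incl"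
        unfolding UN[OF i(4)] k_subsets_Suc
      proof (rule unimodular_incl_exchange)
        show "(\<Union>j\<le>i. ballot n j) \<subseteq> (\<Union>j\<le>Suc i. ballot n j)"
          by (auto simp: atMost_Suc)
      qed (use fresh in blast)
      then show ?thesis using i(3) 3(1) by simp
    qed
  qed
qed

section \<open>Generators of the inclusion structure on ballot sets\<close>

lemma ballot_nonempty: "2 * k \<le> n \<Longrightarrow> ballot n k \<noteq> {}"
proof (induction n arbitrary: k)
  case (Suc n)
  then show ?case by (cases k) (auto simp: ballot_Suc)
qed simp

text \<open>The last conjunct is the required basis property. It is proved together with a
  version for inclusions of generators of size at most \<open>i\<close> in ballot sets of a larger size \<open>k\<close>, where
  only a square submatrix, with columns \<open>R\<close>, is unimodular.

  Deleting the last point by exchange turns this version for \<open>(i, k)\<close> into the claims for \<open>(i, k - 1)\<close>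
  and \<open>(i - 1, k)\<close>, both covered by the bound \<open>2 * k + i \<le> n\<close> or, if \<open>i = k - 1\<close>, by the basis
  property. The basis property for \<open>k\<close> reduces to that for \<open>k\<close> and \<open>k - 1\<close> as long as
  \<open>3 * k \<le> n\<close>, which keeps the smaller cases in range. In the boundary case \<open>3 * k = n + 1\<close> the generators of size \<open>k\<close> are still to be
  chosen: those of smaller size are unimodular on some set \<open>R\<close> of columns, and since ballot sets of equal
  size are included in each other only if they are equal, all columns outside \<open>R\<close> complete them to a
  basis.\<close>

theorem ballot_generators:
  "\<exists>G. (\<forall>j. G j \<subseteq> ballot n j) \<and>
     (\<forall>i k. i < k \<and> 2 * k + i \<le> n \<longrightarrow> (\<exists>R\<subseteq>ballot n k. unimodular_on (\<Union>j\<le>i. G j) R incl)) \<and>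
     (\<forall>k. 3 * k \<le> Suc n \<longrightarrow> unimodular_on (\<Union>j\<le>k. G j) (ballot n k) incl)"
proof (induction n)
  case 0
  show ?case
  proof (intro exI[of _ "\<lambda>j. if j = 0 then {{}} else {}"] conjI allI impI)
    fix k :: nat assume "3 * k \<le> Suc 0"
    then have "k = 0" by simp
    then show "unimodular_on (\<Union>j\<le>k. if j = 0 then {{}} else {}) (ballot 0 k) incl"
      by (simp add: unimodular_incl_singleton)
  qed auto
next
  case (Suc n)
  then obtain G where G: "\<And>j. G j \<subseteq> ballot n j"
    and inj: "\<And>i k. i < k \<Longrightarrow> 2 * k + i \<le> n \<Longrightarrow> \<exists>R\<subseteq>ballot n k. unimodular_on (\<Union>j\<le>i. G j) R incl"
    and free: "\<And>k. 3 * k \<le> Suc n \<Longrightarrow> unimodular_on (\<Union>j\<le>k. G j) (ballot n k) incl"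
    by blast
  have "card (G 0) = 1" using unimodular_on_card[OF free[of 0]] by simp
  then have G0: "G 0 = {{}}" using G[of 0] by (auto simp: subset_singleton_iff)
  \<comment> \<open>In positive sizes, the generators inherited from the deletion of the last point and those
    inherited from its link.\<close>
  define E where "E j = (case j of 0 \<Rightarrow> G 0 | Suc i \<Rightarrow> G (Suc i) \<union> insert (Suc n) ` G i)" for j
  have E_UN: "(\<Union>j\<le>Suc i. E j) = (\<Union>j\<le>Suc i. G j) \<union> insert (Suc n) ` (\<Union>j\<le>i. G j)" for i
    by (rule UN_atMost_Suc_insert) (simp_all add: E_def)
  have E_sub: "E j \<subseteq> ballot (Suc n) j" if "2 * j \<le> Suc n" for j
    using that G G0 by (cases j) (auto simp: E_def ballot_Suc)
  have fresh: "Suc n \<notin> S" if "S \<in> ballot n k" for S k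
    using ballotD[OF that] by auto
  have freshG: "Suc n \<notin> S" if "S \<in> (\<Union>j\<le>i. G j)" for S i
    using that G fresh by blast
  have E_inj: "\<exists>R\<subseteq>ballot (Suc n) k. unimodular_on (\<Union>j\<le>i. E j) R incl"
    if ik: "i < k" "2 * k + i \<le> Suc n" for i k
  proof (cases i)
    case 0
    obtain T where "T \<in> ballot (Suc n) k"
      using ballot_nonempty[of k "Suc n"] ik by auto
    then show ?thesis
      using 0 G0 unimodular_incl_singleton[of T] by (intro exI[of _ "{T}"]) (simp add: E_def)
  next
    case (Suc i')
    then obtain k' where k': "k = Suc k'" "i' < k'" using ik by (cases k) auto
    obtain R2 where R2: "R2 \<subseteq> ballot n k'" "unimodular_on (\<Union>j\<le>i. G j) R2 incl"
    proof (cases "i < k'")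
      case True
      then show ?thesis using inj[of i k'] ik k' that by auto
    next
      case False
      then have "i = k'" using Suc k' by simp
      then show ?thesis using free[of k'] ik k' that by auto
    qed
    obtain R1 where R1: "R1 \<subseteq> ballot n k" "unimodular_on (\<Union>j\<le>i'. G j) R1 incl"
      using inj[of i' k] ik Suc by auto
    have "unimodular_on (\<Union>j\<le>i. E j) (R1 \<union> insert (Suc n) ` R2) incl"
      unfolding Suc E_UN
    proof (rule unimodular_incl_exchange[OF R2(2)[unfolded Suc] R1(2)])
      show "Suc n \<notin> S" if "S \<in> (\<Union>j\<le>Suc i'. G j) \<union> R1 \<union> R2" for S
        using that R1(1) R2(1) fresh freshG by blast
    qed (auto simp: atMost_Suc)
    moreover have "R1 \<union> insert (Suc n) ` R2 \<subseteq> ballot (Suc n) k"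
      using R1(1) R2(1) ik k' by (auto simp: ballot_Suc)
    ultimately show ?thesis by blast
  qed
  have E_free: "unimodular_on (\<Union>j\<le>k. E j) (ballot (Suc n) k) incl" if k: "3 * k \<le> Suc n" for k
  proof (cases k)
    case 0
    then show ?thesis using G0 by (simp add: E_def unimodular_incl_singleton)
  next
    case (Suc k')
    have "unimodular_on (\<Union>j\<le>k. G j) (ballot n k) incl"
        "unimodular_on (\<Union>j\<le>k'. G j) (ballot n k') incl"
      using free k Suc by auto
    then have "unimodular_on ((\<Union>j\<le>Suc k'. G j) \<union> insert (Suc n) ` (\<Union>j\<le>k'. G j))
        (ballot n (Suc k') \<union> insert (Suc n) ` ballot n k') incl"
      unfolding Suc by (rule unimodular_incl_deletion_link) (use fresh freshG in blast)
    then show ?thesis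
      using k unfolding Suc E_UN by (simp add: ballot_Suc)
  qed
  have "\<exists>R. \<forall>k. 3 * Suc k = Suc (Suc n) \<longrightarrow>
      R \<subseteq> ballot (Suc n) (Suc k) \<and> unimodular_on (\<Union>j\<le>k. E j) R incl"
  proof (cases "\<exists>k. 3 * Suc k = Suc (Suc n)")
    case True
    then obtain k where k: "3 * Suc k = Suc (Suc n)" by blast
    then have "\<exists>R\<subseteq>ballot (Suc n) (Suc k). unimodular_on (\<Union>j\<le>k. E j) R incl"
      by (intro E_inj) auto
    moreover have "k' = k" if "3 * Suc k' = Suc (Suc n)" for k'
      using that k by simp
    ultimately show ?thesis by metis
  qed auto
  then obtain R where R: "\<And>k. 3 * Suc k = Suc (Suc n) \<Longrightarrow> R \<subseteq> ballot (Suc n) (Suc k)"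
      "\<And>k. 3 * Suc k = Suc (Suc n) \<Longrightarrow> unimodular_on (\<Union>j\<le>k. E j) R incl"
    by blast
  define G' where "G' j = (if 3 * j \<le> Suc n then E j
      else if 3 * j = Suc (Suc n) then ballot (Suc n) j - R else {})" for j
  have G'_UN: "(\<Union>j\<le>i. G' j) = (\<Union>j\<le>i. E j)" if "3 * i \<le> Suc n" for i
    using that by (auto simp: G'_def)
  show ?case
  proof (intro exI[of _ G'] conjI allI impI)
    show "G' j \<subseteq> ballot (Suc n) j" for j
      using E_sub[of j] by (auto simp: G'_def)
    show "\<exists>R\<subseteq>ballot (Suc n) k. unimodular_on (\<Union>j\<le>i. G' j) R incl"
      if "i < k \<and> 2 * k + i \<le> Suc n" for i k
      using E_inj[of i k] G'_UN[of i] that by auto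
    show "unimodular_on (\<Union>j\<le>k. G' j) (ballot (Suc n) k) incl" if k: "3 * k \<le> Suc (Suc n)" for k
    proof (cases "3 * k \<le> Suc n")
      case True
      then show ?thesis using E_free G'_UN by simp
    next
      case False
      then obtain k' where k': "k = Suc k'" "3 * Suc k' = Suc (Suc n)"
        using k by (cases k) auto
      let ?C = "ballot (Suc n) (Suc k') - R"
      have "unimodular_on ((\<Union>j\<le>k'. E j) \<union> ?C) (R \<union> ?C) incl"
      proof (rule unimodular_on_block_triangular)
        have eq: "S = T" if "S \<subseteq> T" "S \<in> ballot (Suc n) (Suc k')" "T \<in> ballot (Suc n) (Suc k')"
          for S T :: "nat set"
          using that ballotD by (metis card_subset_eq)
        show "unimodular_on (\<Union>j\<le>k'. E j) R incl" by (rule R(2)[OF k'(2)])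
        show "unimodular_on ?C ?C incl"
          by (rule unimodular_on_identity) (use eq in \<open>auto simp: incl_def\<close>)
        show "incl S T = 0" if "S \<in> ?C" "T \<in> R" for S T
          using that eq R(1)[OF k'(2)] by (auto simp: incl_def)
        have "card S \<le> k'" if "S \<in> (\<Union>j\<le>k'. E j)" for S
        proof -
          from that obtain j where j: "j \<le> k'" "S \<in> E j" by blast
          then have "S \<in> ballot (Suc n) j" using E_sub[of j] k' by auto
          then show ?thesis using j ballotD by auto
        qed
        then show "(\<Union>j\<le>k'. E j) \<inter> ?C = {}"
          using ballotD by fastforce
      qed blast
      moreover have "(\<Union>j\<le>k. G' j) = (\<Union>j\<le>k'. E j) \<union> ?C"
      proof -
        have "G' k = ?C" using k' by (simp add: G'_def)
        then show ?thesis using G'_UN[of k'] k' by (simp add: atMost_Suc Un_commute)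
      qed
      moreover have "R \<union> ?C = ballot (Suc n) k" using R(1)[OF k'(2)] k' by blast
      ultimately show ?thesis by simp
    qed
  qed
qed

section \<open>Unimodular equivalence\<close>

text \<open>The equation \<open>M Q = P M'\<close> is used instead of \<open>E M F = M'\<close> because in the main applications \<open>P\<close> and \<open>Q\<close>
  are both given by inclusions, while their inverses are not explicit.\<close>

definition unimodular_equiv ::
  "'a set \<Rightarrow> 'b set \<Rightarrow> ('a \<Rightarrow> 'b \<Rightarrow> int) \<Rightarrow> 'c set \<Rightarrow> 'd set \<Rightarrow> ('c \<Rightarrow> 'd \<Rightarrow> int) \<Rightarrow> bool" where
  "unimodular_equiv A B M A' B' M' \<longleftrightarrow>
     (\<exists>P Q. unimodular_on A A' P \<and> unimodular_on B B' Q \<and>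
       (\<forall>a\<in>A. \<forall>b'\<in>B'. (\<Sum>b\<in>B. M a b * Q b b') = (\<Sum>a'\<in>A'. P a a' * M' a' b')))"

lemma unimodular_equivI:
  assumes "unimodular_on A A' P" "unimodular_on B B' Q"
    and "\<And>a b'. a \<in> A \<Longrightarrow> b' \<in> B' \<Longrightarrow> (\<Sum>b\<in>B. M a b * Q b b') = (\<Sum>a'\<in>A'. P a a' * M' a' b')"
  shows "unimodular_equiv A B M A' B' M'"
  using assms by (auto simp: unimodular_equiv_def)

lemma unimodular_equivE:
  assumes "unimodular_equiv A B M A' B' M'"
  obtains P Q where "unimodular_on A A' P" "unimodular_on B B' Q"
    "\<And>a b'. a \<in> A \<Longrightarrow> b' \<in> B' \<Longrightarrow> (\<Sum>b\<in>B. M a b * Q b b') = (\<Sum>a'\<in>A'. P a a' * M' a' b')"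
  using assms unfolding unimodular_equiv_def by blast

lemma unimodular_equiv_cong:
  assumes "unimodular_equiv A B M A' B' M'"
    and "\<And>a b. a \<in> A \<Longrightarrow> b \<in> B \<Longrightarrow> M a b = N a b"
    and "\<And>a b. a \<in> A' \<Longrightarrow> b \<in> B' \<Longrightarrow> M' a b = N' a b"
  shows "unimodular_equiv A B N A' B' N'"
proof -
  obtain P Q where PQ: "unimodular_on A A' P" "unimodular_on B B' Q"
    "\<And>a b'. a \<in> A \<Longrightarrow> b' \<in> B' \<Longrightarrow> (\<Sum>b\<in>B. M a b * Q b b') = (\<Sum>a'\<in>A'. P a a' * M' a' b')"
    using assms(1) by (rule unimodular_equivE) blast
  show ?thesis
    by (rule unimodular_equivI[OF PQ(1,2)]) (use PQ(3) assms(2,3) in simp)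
qed

lemma unimodular_equiv_sym:
  assumes "unimodular_equiv A B M A' B' M'"
  shows "unimodular_equiv A' B' M' A B M"
proof -
  obtain P Q where PQ: "unimodular_on A A' P" "unimodular_on B B' Q"
    "\<And>a b'. a \<in> A \<Longrightarrow> b' \<in> B' \<Longrightarrow> (\<Sum>b\<in>B. M a b * Q b b') = (\<Sum>a'\<in>A'. P a a' * M' a' b')"
    using assms by (rule unimodular_equivE) blast
  obtain P' where P': "finite A" "finite A'" "right_inverse_on A A' P P'" "right_inverse_on A' A P' P"
      "unimodular_on A' A P'"
    using PQ(1) by (rule unimodular_onE)
  obtain Q' where Q': "finite B" "finite B'" "right_inverse_on B B' Q Q'" "right_inverse_on B' B Q' Q"
      "unimodular_on B' B Q'"
    using PQ(2) by (rule unimodular_onE)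
  show ?thesis
  proof (rule unimodular_equivI[OF P'(5) Q'(5)])
    fix a' b assume ab: "a' \<in> A'" "b \<in> B"
    have "(\<Sum>a\<in>A. P' a' a * M a b) = (\<Sum>a\<in>A. P' a' a * (\<Sum>b1\<in>B. M a b1 * (\<Sum>b'\<in>B'. Q b1 b' * Q' b' b)))"
      using ab Q'(1) by (simp add: right_inverse_onD[OF Q'(3)] sum_of_bool_mult)
    also have "\<dots> = (\<Sum>a\<in>A. P' a' a * (\<Sum>b'\<in>B'. (\<Sum>b1\<in>B. M a b1 * Q b1 b') * Q' b' b))"
      by (simp only: sum_mult_assoc)
    also have "\<dots> = (\<Sum>a\<in>A. P' a' a * (\<Sum>b'\<in>B'. (\<Sum>a1\<in>A'. P a a1 * M' a1 b') * Q' b' b))"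
      by (simp add: PQ(3))
    also have "\<dots> = (\<Sum>a1\<in>A'. (\<Sum>a\<in>A. P' a' a * P a a1) * (\<Sum>b'\<in>B'. M' a1 b' * Q' b' b))"
      by (simp only: sum_mult_assoc)
    also have "\<dots> = (\<Sum>b'\<in>B'. M' a' b' * Q' b' b)"
      using ab P'(2) by (simp add: right_inverse_onD[OF P'(4)] sum_of_bool_mult)
    finally show "(\<Sum>b'\<in>B'. M' a' b' * Q' b' b) = (\<Sum>a\<in>A. P' a' a * M a b)" by simp
  qed
qed

lemma unimodular_equiv_trans:
  assumes "unimodular_equiv A B M A' B' M'" "unimodular_equiv A' B' M' A'' B'' M''"
  shows "unimodular_equiv A B M A'' B'' M''"
proof -
  obtain P Q where PQ: "unimodular_on A A' P" "unimodular_on B B' Q"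
    "\<And>a b'. a \<in> A \<Longrightarrow> b' \<in> B' \<Longrightarrow> (\<Sum>b\<in>B. M a b * Q b b') = (\<Sum>a'\<in>A'. P a a' * M' a' b')"
    using assms(1) by (rule unimodular_equivE) blast
  obtain P' Q' where PQ': "unimodular_on A' A'' P'" "unimodular_on B' B'' Q'"
    "\<And>a b'. a \<in> A' \<Longrightarrow> b' \<in> B'' \<Longrightarrow> (\<Sum>b\<in>B'. M' a b * Q' b b') = (\<Sum>a'\<in>A''. P' a a' * M'' a' b')"
    using assms(2) by (rule unimodular_equivE) blast
  show ?thesis
  proof (rule unimodular_equivI[OF unimodular_on_mult[OF PQ(1) PQ'(1)] unimodular_on_mult[OF PQ(2) PQ'(2)]])
    fix a b assume ab: "a \<in> A" "b \<in> B''"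
    have "(\<Sum>b1\<in>B. M a b1 * (\<Sum>b2\<in>B'. Q b1 b2 * Q' b2 b))
        = (\<Sum>b2\<in>B'. (\<Sum>b1\<in>B. M a b1 * Q b1 b2) * Q' b2 b)"
      by (simp only: sum_mult_assoc)
    also have "\<dots> = (\<Sum>b2\<in>B'. (\<Sum>a1\<in>A'. P a a1 * M' a1 b2) * Q' b2 b)"
      using ab by (simp add: PQ(3))
    also have "\<dots> = (\<Sum>a1\<in>A'. P a a1 * (\<Sum>b2\<in>B'. M' a1 b2 * Q' b2 b))"
      by (simp only: sum_mult_assoc)
    also have "\<dots> = (\<Sum>a1\<in>A'. P a a1 * (\<Sum>a2\<in>A''. P' a1 a2 * M'' a2 b))"
      using ab by (simp add: PQ'(3))
    also have "\<dots> = (\<Sum>a2\<in>A''. (\<Sum>a1\<in>A'. P a a1 * P' a1 a2) * M'' a2 b)"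
      by (simp only: sum_mult_assoc)
    finally show "(\<Sum>b1\<in>B. M a b1 * (\<Sum>b2\<in>B'. Q b1 b2 * Q' b2 b))
        = (\<Sum>a2\<in>A''. (\<Sum>a1\<in>A'. P a a1 * P' a1 a2) * M'' a2 b)" .
  qed
qed

lemma unimodular_equiv_relabel:
  assumes "unimodular_equiv A B M A' B' M'"
    and f: "bij_betw f A1 A" and g: "bij_betw g B1 B"
    and f': "bij_betw f' A1' A'" and g': "bij_betw g' B1' B'"
  shows "unimodular_equiv A1 B1 (\<lambda>a b. M (f a) (g b)) A1' B1' (\<lambda>a b. M' (f' a) (g' b))"
proof -
  obtain P Q where PQ: "unimodular_on A A' P" "unimodular_on B B' Q"
    "\<And>a b'. a \<in> A \<Longrightarrow> b' \<in> B' \<Longrightarrow> (\<Sum>b\<in>B. M a b * Q b b') = (\<Sum>a'\<in>A'. P a a' * M' a' b')"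
    using assms(1) by (rule unimodular_equivE) blast
  show ?thesis
  proof (rule unimodular_equivI[OF unimodular_on_relabel[OF PQ(1) f f'] unimodular_on_relabel[OF PQ(2) g g']])
    fix a b' assume ab: "a \<in> A1" "b' \<in> B1'"
    have "(\<Sum>b\<in>B1. M (f a) (g b) * Q (g b) (g' b')) = (\<Sum>b\<in>B. M (f a) b * Q b (g' b'))"
      by (rule sum.reindex_bij_betw[OF g])
    also have "\<dots> = (\<Sum>a'\<in>A'. P (f a) a' * M' a' (g' b'))"
      using ab f g' by (intro PQ(3)) (auto simp: bij_betw_def)
    also have "\<dots> = (\<Sum>a'\<in>A1'. P (f a) (f' a') * M' (f' a') (g' b'))"
      by (rule sum.reindex_bij_betw[OF f', symmetric])
    finally show "(\<Sum>b\<in>B1. M (f a) (g b) * Q (g b) (g' b'))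
      = (\<Sum>a'\<in>A1'. P (f a) (f' a') * M' (f' a') (g' b'))" .
  qed
qed

lemma sum_restrict_fibre:
  fixes f :: "_ \<Rightarrow> int"
  assumes "finite B" "\<And>b. b \<in> B \<Longrightarrow> q b \<noteq> i \<Longrightarrow> f b = 0"
  shows "sum f B = sum f {b\<in>B. q b = i}"
  using assms by (intro sum.mono_neutral_right) auto

lemma unimodular_equiv_block_diagonal:
  assumes fin: "finite A" "finite B" "finite A'" "finite B'"
    and blocks: "\<And>i. unimodular_equiv {a\<in>A. p a = i} {b\<in>B. q b = i} M
      {a\<in>A'. p' a = i} {b\<in>B'. q' b = i} M'"
    and zero: "\<And>a b. a \<in> A \<Longrightarrow> b \<in> B \<Longrightarrow> p a \<noteq> q b \<Longrightarrow> M a b = 0"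
      "\<And>a b. a \<in> A' \<Longrightarrow> b \<in> B' \<Longrightarrow> p' a \<noteq> q' b \<Longrightarrow> M' a b = 0"
  shows "unimodular_equiv A B M A' B' M'"
proof -
  have "\<forall>i. \<exists>PQ. unimodular_on {a\<in>A. p a = i} {a\<in>A'. p' a = i} (fst PQ) \<and>
      unimodular_on {b\<in>B. q b = i} {b\<in>B'. q' b = i} (snd PQ) \<and>
      (\<forall>a\<in>{a\<in>A. p a = i}. \<forall>b'\<in>{b\<in>B'. q' b = i}. (\<Sum>b\<in>{b\<in>B. q b = i}. M a b * snd PQ b b')
        = (\<Sum>a'\<in>{a\<in>A'. p' a = i}. fst PQ a a' * M' a' b'))"
    using blocks unfolding unimodular_equiv_def by simp
  from choice[OF this] obtain PQ where PQ: "\<forall>i. unimodular_on {a\<in>A. p a = i} {a\<in>A'. p' a = i} (fst (PQ i)) \<and>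
      unimodular_on {b\<in>B. q b = i} {b\<in>B'. q' b = i} (snd (PQ i)) \<and>
      (\<forall>a\<in>{a\<in>A. p a = i}. \<forall>b'\<in>{b\<in>B'. q' b = i}. (\<Sum>b\<in>{b\<in>B. q b = i}. M a b * snd (PQ i) b b')
        = (\<Sum>a'\<in>{a\<in>A'. p' a = i}. fst (PQ i) a a' * M' a' b'))"
    by blast
  define P where "P a a' = (if p a = p' a' then fst (PQ (p a)) a a' else 0)" for a a'
  define Q where "Q b b' = (if q b = q' b' then snd (PQ (q b)) b b' else 0)" for b b'
  show ?thesis
  proof (rule unimodular_equivI)
    show "unimodular_on A A' P"
    proof (rule unimodular_on_block_diagonal[OF fin(1,3), where p = p and q = p'])
      fix i
      have "unimodular_on {a\<in>A. p a = i} {a\<in>A'. p' a = i} (fst (PQ i))" using PQ by blast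
      then show "unimodular_on {a\<in>A. p a = i} {a\<in>A'. p' a = i} P"
        by (rule unimodular_on_cong) (simp add: P_def)
    qed (simp add: P_def)
    show "unimodular_on B B' Q"
    proof (rule unimodular_on_block_diagonal[OF fin(2,4), where p = q and q = q'])
      fix i
      have "unimodular_on {b\<in>B. q b = i} {b\<in>B'. q' b = i} (snd (PQ i))" using PQ by blast
      then show "unimodular_on {b\<in>B. q b = i} {b\<in>B'. q' b = i} Q"
        by (rule unimodular_on_cong) (simp add: Q_def)
    qed (simp add: Q_def)
    fix a b' assume ab: "a \<in> A" "b' \<in> B'"
    have l: "(\<Sum>b\<in>B. M a b * Q b b') = (\<Sum>b\<in>{b\<in>B. q b = p a}. M a b * Q b b')"
      using zero(1)[OF ab(1)] by (intro sum_restrict_fibre fin) force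
    have r: "(\<Sum>a'\<in>A'. P a a' * M' a' b') = (\<Sum>a'\<in>{a'\<in>A'. p' a' = p a}. P a a' * M' a' b')"
      by (intro sum_restrict_fibre fin) (simp add: P_def)
    show "(\<Sum>b\<in>B. M a b * Q b b') = (\<Sum>a'\<in>A'. P a a' * M' a' b')"
    proof (cases "p a = q' b'")
      case True
      have "(\<Sum>b\<in>{b\<in>B. q b = p a}. M a b * Q b b')
          = (\<Sum>b\<in>{b\<in>B. q b = p a}. M a b * snd (PQ (p a)) b b')"
        using True by (intro sum.cong) (simp_all add: Q_def)
      also have "\<dots> = (\<Sum>a'\<in>{a'\<in>A'. p' a' = p a}. fst (PQ (p a)) a a' * M' a' b')"
        using PQ ab True by simp
      also have "\<dots> = (\<Sum>a'\<in>{a'\<in>A'. p' a' = p a}. P a a' * M' a' b')"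
        by (intro sum.cong) (simp_all add: P_def)
      finally show ?thesis using l r by simp
    next
      case False
      have "(\<Sum>b\<in>{b\<in>B. q b = p a}. M a b * Q b b') = 0"
        using False by (intro sum.neutral) (simp add: Q_def)
      moreover have "(\<Sum>a'\<in>{a'\<in>A'. p' a' = p a}. P a a' * M' a' b') = 0"
        using False ab zero(2) by (intro sum.neutral) simp
      ultimately show ?thesis using l r by simp
    qed
  qed
qed

section \<open>Translation to matrices indexed by initial segments\<close>

lemma mult_mat_of_fun:
  "mat n m (\<lambda>(i, j). f i j) * mat m k (\<lambda>(i, j). g i j)
     = mat n k (\<lambda>(i, j). \<Sum>x<m. f i x * g x j :: int)"
  by (rule eq_matI) (auto simp: scalar_prod_def lessThan_atLeast0)

lemma mult_mat_entry:
  assumes "X \<in> carrier_mat n m" "Y \<in> carrier_mat m k" "i < n" "j < k"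
  shows "(X * Y) $$ (i, j) = (\<Sum>x<m. X $$ (i, x) * Y $$ (x, j) :: int)"
  using assms by (simp add: scalar_prod_def lessThan_atLeast0)

lemma right_inverse_on_mat:
  assumes "right_inverse_on {..<n} {..<m} M N"
  shows "mat n m (\<lambda>(i, j). M i j) * mat m n (\<lambda>(i, j). N i j) = 1\<^sub>m n"
  unfolding mult_mat_of_fun
  by (rule eq_matI) (auto simp: right_inverse_onD[OF assms])

lemma invertible_mat_unimodular:
  fixes E :: "int mat"
  assumes E: "E \<in> carrier_mat n n" "invertible_mat E"
  obtains E' where "E' \<in> carrier_mat n n" "E' * E = 1\<^sub>m n"
    "unimodular_on {..<n} {..<n} (\<lambda>i j. E $$ (i, j))"
    "unimodular_on {..<n} {..<n} (\<lambda>i j. E' $$ (i, j))"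
proof -
  obtain E' where inv: "E * E' = 1\<^sub>m n" "E' * E = 1\<^sub>m (dim_row E')"
    using E unfolding invertible_mat_def inverts_mat_def by auto
  have "dim_row E' = n" "dim_col E' = n"
    using arg_cong[OF inv(1), of dim_col] arg_cong[OF inv(2), of dim_col] E(1) by auto
  then have E': "E' \<in> carrier_mat n n" by auto
  have "right_inverse_on {..<n} {..<n} (\<lambda>i j. X $$ (i, j)) (\<lambda>i j. Y $$ (i, j))"
    if "X \<in> carrier_mat n n" "Y \<in> carrier_mat n n" "X * Y = 1\<^sub>m n" for X Y :: "int mat"
    unfolding right_inverse_on_def
  proof (intro ballI)
    fix i j assume ij: "i \<in> {..<n}" "j \<in> {..<n}"
    then have "(\<Sum>x<n. X $$ (i, x) * Y $$ (x, j)) = (X * Y) $$ (i, j)"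
      using that by (intro mult_mat_entry[symmetric]) auto
    also have "\<dots> = of_bool (i = j)"
      unfolding that(3) using ij by simp
    finally show "(\<Sum>x<n. X $$ (i, x) * Y $$ (x, j)) = of_bool (i = j)" .
  qed
  then have "right_inverse_on {..<n} {..<n} (\<lambda>i j. E $$ (i, j)) (\<lambda>i j. E' $$ (i, j))"
      "right_inverse_on {..<n} {..<n} (\<lambda>i j. E' $$ (i, j)) (\<lambda>i j. E $$ (i, j))"
    using E E' inv \<open>dim_row E' = n\<close> by auto
  then have "unimodular_on {..<n} {..<n} (\<lambda>i j. E $$ (i, j))"
      "unimodular_on {..<n} {..<n} (\<lambda>i j. E' $$ (i, j))"
    by (auto intro: unimodular_onI)
  with E' inv(2) \<open>dim_row E' = n\<close> show thesis using that by auto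
qed

lemma diagonal_form_unimodular_equiv:
  assumes "diagonal_form M D" "M \<in> carrier_mat n m"
  shows "unimodular_equiv {..<n} {..<m} (\<lambda>i j. M $$ (i, j)) {..<n} {..<m} (\<lambda>i j. D $$ (i, j))"
proof -
  obtain E F where EF: "E \<in> carrier_mat n n" "invertible_mat E" "F \<in> carrier_mat m m"
      "invertible_mat F" "E * M * F = D" and D: "D \<in> carrier_mat n m"
    using assms unfolding diagonal_form_def by auto
  obtain E' where E': "E' \<in> carrier_mat n n" "E' * E = 1\<^sub>m n"
      "unimodular_on {..<n} {..<n} (\<lambda>i j. E' $$ (i, j))"
    using EF(1,2) by (rule invertible_mat_unimodular) blast
  have F: "unimodular_on {..<m} {..<m} (\<lambda>i j. F $$ (i, j))"
    using EF(3,4) by (rule invertible_mat_unimodular) blast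
  have MF: "M * F \<in> carrier_mat n m" using assms(2) EF(3) by simp
  have "E' * D = E' * (E * (M * F))"
    using assoc_mult_mat[OF EF(1) assms(2) EF(3)] EF(5) by simp
  also have "\<dots> = M * F"
    using assoc_mult_mat[OF E'(1) EF(1) MF] E'(2) left_mult_one_mat[OF MF] by simp
  finally have eq: "M * F = E' * D" ..
  show ?thesis
  proof (rule unimodular_equivI[OF E'(3) F])
    fix i j assume ij: "i \<in> {..<n}" "j \<in> {..<m}"
    then have "(\<Sum>x<m. M $$ (i, x) * F $$ (x, j)) = (M * F) $$ (i, j)"
      using EF(3) assms(2) by (intro mult_mat_entry[symmetric]) auto
    also have "\<dots> = (\<Sum>x<n. E' $$ (i, x) * D $$ (x, j))"
      unfolding eq using ij E'(1) D by (intro mult_mat_entry) auto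
    finally show "(\<Sum>x<m. M $$ (i, x) * F $$ (x, j)) = (\<Sum>x<n. E' $$ (i, x) * D $$ (x, j))" .
  qed
qed

lemma unimodular_equiv_diagonal_form:
  assumes "unimodular_equiv {..<n} {..<m} M {..<n} {..<m} D"
    and diag: "\<And>i j. i < n \<Longrightarrow> j < m \<Longrightarrow> i \<noteq> j \<Longrightarrow> D i j = 0"
  shows "diagonal_form (mat n m (\<lambda>(i, j). M i j)) (mat n m (\<lambda>(i, j). D i j))"
proof -
  obtain P Q where PQ: "unimodular_on {..<n} {..<n} P" "unimodular_on {..<m} {..<m} Q"
    "\<And>a b'. a \<in> {..<n} \<Longrightarrow> b' \<in> {..<m} \<Longrightarrow> (\<Sum>b<m. M a b * Q b b') = (\<Sum>a'<n. P a a' * D a' b')"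
    using assms(1) by (rule unimodular_equivE) blast
  obtain P' where P': "right_inverse_on {..<n} {..<n} P P'" "right_inverse_on {..<n} {..<n} P' P"
    using PQ(1) by (rule unimodular_onE)
  obtain Q' where Q': "right_inverse_on {..<m} {..<m} Q Q'" "right_inverse_on {..<m} {..<m} Q' Q"
    using PQ(2) by (rule unimodular_onE)
  define mt where "mt a b f = mat a b (\<lambda>(i, j). f i j)" for a b and f :: "nat \<Rightarrow> nat \<Rightarrow> int"
  have carrier: "mt a b f \<in> carrier_mat a b" for a b f by (simp add: mt_def)
  have inv: "mt n n P * mt n n P' = 1\<^sub>m n" "mt n n P' * mt n n P = 1\<^sub>m n"
      "mt m m Q * mt m m Q' = 1\<^sub>m m" "mt m m Q' * mt m m Q = 1\<^sub>m m"
    using right_inverse_on_mat P' Q' unfolding mt_def by blast+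
  have "invertible_mat (mt n n P')" "invertible_mat (mt m m Q)"
    using inv carrier unfolding invertible_mat_def inverts_mat_def square_mat.simps
    by (metis carrier_matD)+
  moreover have "mt n m M * mt m m Q = mt n n P * mt n m D"
    unfolding mt_def mult_mat_of_fun by (rule eq_matI) (use PQ(3) in auto)
  then have "mt n n P' * (mt n m M * mt m m Q) = (mt n n P' * mt n n P) * mt n m D"
    using carrier by (simp add: assoc_mult_mat[of _ n n _ n _ m])
  then have "mt n n P' * mt n m M * mt m m Q = mt n m D"
    using carrier by (simp add: inv assoc_mult_mat[of _ n n _ m _ m] left_mult_one_mat[of _ n m])
  moreover have "diagonal_mat (mt n m D)"
    using diag by (auto simp: diagonal_mat_def mt_def)
  ultimately show ?thesis
    unfolding diagonal_form_def mt_def[symmetric] using carrier by (metis carrier_matD)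
qed

section \<open>Intersection numbers\<close>

lemma alternating_choose_mult_sum:
  assumes "v \<le> m"
  shows "(\<Sum>i=v..m. (- 1) ^ (i + v) * int (m choose i) * int (i choose v)) = of_bool (v = m)"
proof -
  have "(\<Sum>i=v..m. (- 1) ^ (i + v) * int (m choose i) * int (i choose v))
      = (\<Sum>i=v..m. int (m choose v) * ((- 1) ^ (i - v) * int ((m - v) choose (i - v))))"
  proof (rule sum.cong)
    fix i assume i: "i \<in> {v..m}"
    then have "(m choose i) * (i choose v) = (m choose v) * ((m - v) choose (i - v))"
      by (intro choose_mult) auto
    then have "int (m choose i) * int (i choose v) = int (m choose v) * int ((m - v) choose (i - v))"
      by (metis of_nat_mult)
    moreover have "(- 1 :: int) ^ (i + v) = (- 1) ^ (i - v)"
      using i by (intro minus_one_power_iff[THEN trans]) (auto simp: minus_one_power_iff)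
    ultimately show "(- 1) ^ (i + v) * int (m choose i) * int (i choose v)
        = int (m choose v) * ((- 1) ^ (i - v) * int ((m - v) choose (i - v)))"
      by (simp add: mult.assoc mult.left_commute)
  qed simp
  also have "\<dots> = int (m choose v) * (\<Sum>t\<le>m - v. (- 1) ^ t * int ((m - v) choose t))"
    unfolding sum_distrib_left
    by (rule sum.reindex_bij_witness[where i = "\<lambda>t. t + v" and j = "\<lambda>i. i - v"])
       (use assms in auto)
  also have "\<dots> = of_bool (v = m)"
  proof (cases "v = m")
    case False
    then show ?thesis using assms choose_alternating_sum[of "m - v", where ?'a = int] by simp
  qed simp
  finally show ?thesis .
qed

text \<open>Newton's expansion of \<open>f\<close> in the basis \<open>m choose i\<close>; the coefficients are its iterated
  differences at 0.\<close>

lemma newton_expansion: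
  fixes f :: "nat \<Rightarrow> int"
  shows "(\<Sum>i\<le>m. int (m choose i) * (\<Sum>v\<le>i. (- 1) ^ (i + v) * int (i choose v) * f v)) = f m"
proof -
  have "(\<Sum>i\<le>m. int (m choose i) * (\<Sum>v\<le>i. (- 1) ^ (i + v) * int (i choose v) * f v))
      = (\<Sum>i\<le>m. \<Sum>v\<le>i. ((- 1) ^ (i + v) * int (m choose i) * int (i choose v)) * f v)"
    by (simp add: sum_distrib_left ac_simps)
  also have "\<dots> = (\<Sum>v\<le>m. \<Sum>i=v..m. ((- 1) ^ (i + v) * int (m choose i) * int (i choose v)) * f v)"
  proof -
    have "(\<Sum>i\<le>m. \<Sum>v\<le>i. g i v) = (\<Sum>v\<le>m. \<Sum>i=v..m. g i v)" for g :: "nat \<Rightarrow> nat \<Rightarrow> int"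
    proof -
      have "(\<Sum>i\<le>m. \<Sum>v\<le>i. g i v) = (\<Sum>i\<le>m. \<Sum>v\<in>{v\<in>{..m}. v \<le> i}. g i v)"
        by (intro sum.cong) auto
      also have "\<dots> = (\<Sum>v\<le>m. \<Sum>i\<in>{i\<in>{..m}. v \<le> i}. g i v)"
        by (rule sum.swap_restrict) auto
      also have "\<dots> = (\<Sum>v\<le>m. \<Sum>i=v..m. g i v)"
        by (intro sum.cong) auto
      finally show ?thesis .
    qed
    then show ?thesis .
  qed
  also have "\<dots> = (\<Sum>v\<le>m. of_bool (v = m) * f v)"
    by (simp flip: sum_distrib_right add: alternating_choose_mult_sum)
  also have "\<dots> = f m" by (rule sum_of_bool_mult) auto
  finally show ?thesis .
qed

lemma sum_Pow_card:
  fixes h :: "nat \<Rightarrow> int"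
  assumes "finite A"
  shows "(\<Sum>X\<in>Pow A. h (card X)) = (\<Sum>i\<le>card A. int (card A choose i) * h i)"
proof -
  have "(\<Sum>X\<in>Pow A. h (card X)) = (\<Sum>i\<le>card A. \<Sum>X\<in>{X\<in>Pow A. card X = i}. h (card X))"
    by (rule sum.group[symmetric]) (use assms in \<open>auto intro: card_mono\<close>)
  also have "\<dots> = (\<Sum>i\<le>card A. int (card {X. X \<subseteq> A \<and> card X = i}) * h i)"
    by (intro sum.cong) (auto simp: Pow_def)
  finally show ?thesis using n_subsets[OF assms] by simp
qed

lemma ibinom_of_nat: "ibinom (int a) (int b) = int (a choose b)"
  by (simp add: ibinom_def binomial_eq_0)

lemma ibinom_diff:
  "b \<le> a \<Longrightarrow> c \<le> d \<Longrightarrow> ibinom (int a - int b) (int d - int c) = int ((a - b) choose (d - c))"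
  using ibinom_of_nat[of "a - b" "d - c"] by (simp add: of_nat_diff)

lemma card_interval_subsets:
  assumes "finite T" "S \<subseteq> T"
  shows "card {X. S \<subseteq> X \<and> X \<subseteq> T \<and> card X = card S + i} = (card T - card S) choose i"
proof -
  have fin: "finite S" using assms finite_subset by blast
  have "bij_betw (\<lambda>X. X - S) {X. S \<subseteq> X \<and> X \<subseteq> T \<and> card X = card S + i}
      {X. X \<subseteq> T - S \<and> card X = i}"
  proof (rule bij_betw_byWitness[where f' = "\<lambda>X. X \<union> S"])
    show "(\<lambda>X. X - S) ` {X. S \<subseteq> X \<and> X \<subseteq> T \<and> card X = card S + i} \<subseteq> {X. X \<subseteq> T - S \<and> card X = i}"
      using fin by (auto simp: card_Diff_subset)
    have "card (X \<union> S) = card S + i" if "X \<subseteq> T - S" "card X = i" for X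
      using that assms fin by (subst card_Un_disjoint) (auto dest: finite_subset)
    then show "(\<lambda>X. X \<union> S) ` {X. X \<subseteq> T - S \<and> card X = i}
        \<subseteq> {X. S \<subseteq> X \<and> X \<subseteq> T \<and> card X = card S + i}"
      using assms by auto
  qed auto
  from bij_betw_same_card[OF this] show ?thesis
    using n_subsets[of "T - S" i] assms fin by (simp add: card_Diff_subset)
qed

text \<open>A set \<open>B\<close> containing \<open>T\<close> with \<open>card (A \<inter> B) = l\<close> consists of \<open>T\<close>, some points of \<open>A - T\<close> and
  some points outside \<open>A \<union> T\<close>, and the sizes of the last two parts are determined.\<close>

lemma card_containing_with_intersection:
  assumes A: "A \<in> k_subsets n kr" and T: "T \<subseteq> {1..n}" and l: "l \<le> kr" "l \<le> kc"
  shows "int (card {B \<in> k_subsets n kc. T \<subseteq> B \<and> card (A \<inter> B) = l})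
    = ibinom (int kr - int (card (A \<inter> T))) (int l - int (card (A \<inter> T)))
      * ibinom (int n - int kr - int (card T) + int (card (A \<inter> T)))
          (int kc - int l - int (card T) + int (card (A \<inter> T)))"
proof -
  define v j where "v = card (A \<inter> T)" and "j = card T"
  have A': "A \<subseteq> {1..n}" "card A = kr" "finite A" using A by (auto simp: k_subsets_def dest: finite_subset)
  have T': "finite T" using T finite_subset by blast
  let ?Bs = "{B \<in> k_subsets n kc. T \<subseteq> B \<and> card (A \<inter> B) = l}"
  have v: "v \<le> kr" "v \<le> j" using A' T' by (auto simp: v_def j_def intro: card_mono)
  have card_AT: "card (A \<union> T) = kr + j - v"
    using card_Un_Int[OF A'(3) T'] A'(2) by (simp add: v_def j_def)
  have card_TA: "card (T - A) = j - v"
    using T' by (subst card_Diff_subset_Int) (auto simp: v_def j_def Int_commute)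
  have card_A_T: "card (A - T) = kr - v"
    using A' by (subst card_Diff_subset_Int) (auto simp: v_def)
  have "card (A \<union> T) \<le> card {1..n}" using A' T by (intro card_mono) auto
  then have n: "kr + j - v \<le> n" using card_AT by simp
  consider "l < v" | "kc + v < l + j" | "v \<le> l" "l + j \<le> kc + v" by linarith
  then show ?thesis
  proof cases
    case 1
    have "card (A \<inter> B) \<noteq> l" if "T \<subseteq> B" for B
    proof -
      have "v \<le> card (A \<inter> B)" unfolding v_def using that A' by (intro card_mono) auto
      then show ?thesis using 1 by simp
    qed
    then have "?Bs = {}" by blast
    then show ?thesis using 1 by (simp only:) (simp add: ibinom_def v_def)
  next
    case 2
    have "card (A \<inter> B) \<noteq> l" if "T \<subseteq> B" "B \<in> k_subsets n kc" for B
    proof -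
      have B: "finite B" "card B = kc" using that(2) by (auto simp: k_subsets_def dest: finite_subset)
      have "j - v \<le> card (B - A)" unfolding card_TA[symmetric] using that B by (intro card_mono) auto
      also have "card (B - A) = kc - card (A \<inter> B)"
        using B by (subst card_Diff_subset_Int) (auto simp: Int_commute)
      finally show ?thesis using 2 v l by auto
    qed
    then have "?Bs = {}" by blast
    then show ?thesis using 2 by (simp only:) (simp add: ibinom_def v_def j_def)
  next
    case 3
    define c where "c = kc + v - (l + j)"
    let ?X = "{X. X \<subseteq> A - T \<and> card X = l - v}"
    let ?Y = "{Y. Y \<subseteq> {1..n} - (A \<union> T) \<and> card Y = c}"
    have "bij_betw (\<lambda>B. (B \<inter> (A - T), B - (A \<union> T))) ?Bs (?X \<times> ?Y)"
    proof (rule bij_betw_byWitness[where f' = "\<lambda>(X, Y). T \<union> X \<union> Y"])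
      show "\<forall>B\<in>?Bs. (\<lambda>(X, Y). T \<union> X \<union> Y) (B \<inter> (A - T), B - (A \<union> T)) = B" by auto
      show "\<forall>XY\<in>?X \<times> ?Y. (\<lambda>B. (B \<inter> (A - T), B - (A \<union> T))) ((\<lambda>(X, Y). T \<union> X \<union> Y) XY) = XY"
        by auto
      show "(\<lambda>B. (B \<inter> (A - T), B - (A \<union> T))) ` ?Bs \<subseteq> ?X \<times> ?Y"
      proof (clarsimp, intro conjI)
        fix B assume B: "B \<in> k_subsets n kc" "T \<subseteq> B" "l = card (A \<inter> B)"
        then have B': "finite B" "card B = kc" "B \<subseteq> {1..n}"
          by (auto simp: k_subsets_def dest: finite_subset)
        have "card (B \<inter> (A - T)) = card ((A \<inter> B) - (A \<inter> T))" by (rule arg_cong[of _ _ card]) auto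
        also have "\<dots> = l - v"
          using A' B by (subst card_Diff_subset) (auto simp: v_def)
        finally show "card (B \<inter> (A - T)) = card (A \<inter> B) - v" using B by simp
        have "card (B - (A \<union> T)) = card (B - ((A \<inter> B) \<union> (T - A)))" by (rule arg_cong[of _ _ card]) auto
        also have "\<dots> = kc - card ((A \<inter> B) \<union> (T - A))"
          using A' B B' T' by (subst card_Diff_subset) auto
        also have "card ((A \<inter> B) \<union> (T - A)) = l + (j - v)"
          using A' B T' card_TA by (subst card_Un_disjoint) auto
        finally show "card (B - (A \<union> T)) = c" using v 3 by (simp add: c_def)
        show "B - (A \<union> T) \<subseteq> {Suc 0..n} - (A \<union> T)" using B' by auto
      qed
      show "(\<lambda>(X, Y). T \<union> X \<union> Y) ` (?X \<times> ?Y) \<subseteq> ?Bs"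
      proof (rule image_subsetI)
        fix p assume "p \<in> ?X \<times> ?Y"
        then obtain X Y where p: "p = (X, Y)"
          and XY: "X \<subseteq> A - T" "card X = l - v" "Y \<subseteq> {1..n} - (A \<union> T)" "card Y = c" by auto
        have fin: "finite X" "finite Y" using XY A' by (auto dest: finite_subset)
        have "card (T \<union> X \<union> Y) = card (T \<union> X) + card Y"
          by (rule card_Un_disjoint) (use fin XY T' in auto)
        also have "card (T \<union> X) = card T + card X"
          by (rule card_Un_disjoint) (use fin XY T' in auto)
        finally have "card (T \<union> X \<union> Y) = kc" using XY v 3 by (simp add: c_def j_def)
        moreover have "card (A \<inter> (T \<union> X \<union> Y)) = l"
        proof -
          have "A \<inter> (T \<union> X \<union> Y) = (A \<inter> T) \<union> X" using XY by auto
          then have "card (A \<inter> (T \<union> X \<union> Y)) = card (A \<inter> T) + card X"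
            using fin XY(1) T' by (simp only:) (rule card_Un_disjoint, auto)
          then show ?thesis using XY 3 by (simp add: v_def)
        qed
        moreover have "T \<union> X \<union> Y \<subseteq> {1..n}" using T A' XY by auto
        ultimately show "(\<lambda>(X, Y). T \<union> X \<union> Y) p \<in> ?Bs"
          by (simp add: p k_subsets_def) blast
      qed
    qed
    from bij_betw_same_card[OF this]
    have "card ?Bs = ((kr - v) choose (l - v)) * ((n - (kr + j - v)) choose c)"
      using A' T T' n_subsets[of "A - T" "l - v"] n_subsets[of "{1..n} - (A \<union> T)" c]
      by (simp add: card_cartesian_product card_A_T card_Diff_subset card_AT)
    moreover have "int n - int kr - int j + int v = int (n - (kr + j - v))"
        "int kc - int l - int j + int v = int c"
      using n v 3 by (simp_all add: c_def of_nat_diff)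
    moreover have "ibinom (int kr - int v) (int l - int v) = int ((kr - v) choose (l - v))"
      by (rule ibinom_diff[OF v(1) 3(1)])
    ultimately show ?thesis
      unfolding v_def[symmetric] j_def[symmetric] by (simp only: ibinom_of_nat of_nat_mult)
  qed
qed

text \<open>The Newton coefficients of the intersection number in \<open>card_containing_with_intersection\<close>, as a
  function of \<open>card (A \<inter> T)\<close>, for \<open>j = card T\<close>.\<close>

definition newton_coeff :: "nat \<Rightarrow> nat \<Rightarrow> nat \<Rightarrow> nat \<Rightarrow> nat \<Rightarrow> nat \<Rightarrow> int" where
  "newton_coeff n kr kc l i j = (\<Sum>v = 0..i. (-1) ^ (i + v) * ibinom (int i) (int v)
        * ibinom (int kr - int v) (int l - int v)
        * ibinom (int n - int kr - int j + int v) (int kc - int l - int j + int v))"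

lemma M_entry_newton_coeff:
  "M_entry n kr kc l s i j = ibinom (int j - int s) (int i - int s) * newton_coeff n kr kc l i j"
  by (simp add: M_entry_def newton_coeff_def)

lemma newton_coeff_sum:
  "(\<Sum>i\<le>m. int (m choose i) * newton_coeff n kr kc l i j)
    = ibinom (int kr - int m) (int l - int m)
      * ibinom (int n - int kr - int j + int m) (int kc - int l - int j + int m)"
proof -
  let ?f = "\<lambda>v. ibinom (int kr - int v) (int l - int v)
        * ibinom (int n - int kr - int j + int v) (int kc - int l - int j + int v)"
  have "newton_coeff n kr kc l i j = (\<Sum>v\<le>i. (- 1) ^ (i + v) * int (i choose v) * ?f v)" for i
    by (simp add: newton_coeff_def ibinom_of_nat atMost_atLeast0 mult.assoc)
  then show ?thesis using newton_expansion[of m ?f] by simp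
qed

text \<open>The left-hand side is an intersection number, and by Newton's expansion it is a sum over
  the subsets \<open>T'\<close> of \<open>A \<inter> T\<close>. All of them are ballot sets since \<open>T\<close> is one.\<close>

lemma intersection_incl_product:
  assumes A: "A \<in> k_subsets n kr" and T: "T \<in> ballot n j" and l: "l \<le> kr" "l \<le> kc"
  shows "(\<Sum>B\<in>k_subsets n kc. of_bool (card (A \<inter> B) = l) * incl T B)
    = (\<Sum>T'\<in>(\<Union>i\<le>kr. ballot n i). incl T' A * (newton_coeff n kr kc l (card T') (card T) * incl T' T))"
proof -
  have A': "A \<subseteq> {1..n}" "card A = kr" "finite A" using A by (auto simp: k_subsets_def dest: finite_subset)
  have "(\<Sum>B\<in>k_subsets n kc. of_bool (card (A \<inter> B) = l) * incl T B)
      = (\<Sum>B\<in>{B\<in>k_subsets n kc. T \<subseteq> B \<and> card (A \<inter> B) = l}. 1)"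
    by (rule sum.mono_neutral_cong_right) (auto simp: incl_def)
  also have "\<dots> = int (card {B\<in>k_subsets n kc. T \<subseteq> B \<and> card (A \<inter> B) = l})" by simp
  also have "\<dots> = (\<Sum>i\<le>card (A \<inter> T). int (card (A \<inter> T) choose i) * newton_coeff n kr kc l i (card T))"
    unfolding newton_coeff_sum
    by (rule card_containing_with_intersection[OF A _ l]) (use ballotD[OF T] in auto)
  also have "\<dots> = (\<Sum>T'\<in>Pow (A \<inter> T). newton_coeff n kr kc l (card T') (card T))"
    using A'(3) by (subst sum_Pow_card) auto
  also have "\<dots> = (\<Sum>T'\<in>(\<Union>i\<le>kr. ballot n i).
      incl T' A * (newton_coeff n kr kc l (card T') (card T) * incl T' T))"
  proof (rule sum.mono_neutral_cong_left)
    show "Pow (A \<inter> T) \<subseteq> (\<Union>i\<le>kr. ballot n i)"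
    proof
      fix T' assume "T' \<in> Pow (A \<inter> T)"
      then have "T' \<in> ballot n (card T')" "card T' \<le> kr"
        using ballot_subset[of T' T n j] T A' card_mono[of A T'] by auto
      then show "T' \<in> (\<Union>i\<le>kr. ballot n i)" by blast
    qed
  qed (auto simp: incl_def)
  finally show ?thesis .
qed

section \<open>Splitting into chains\<close>

text \<open>Every generator \<open>S\<close> has one copy \<open>(S, i)\<close> in each degree \<open>i\<close> from its size up to \<open>k\<close>. The copy in
  degree \<open>i\<close> stands for the vector of inclusions of \<open>S\<close> in the ballot sets of size \<open>i\<close>.\<close>

definition chain_index :: "(nat \<Rightarrow> 'a set set) \<Rightarrow> nat \<Rightarrow> ('a set \<times> nat) set" where
  "chain_index G k = (SIGMA S:(\<Union>j\<le>k. G j). {card S..k})"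

definition chain_incl :: "'a set \<times> nat \<Rightarrow> 'a set \<Rightarrow> int" where
  "chain_incl x T = of_bool (card T = snd x) * incl (fst x) T"

definition graded :: "(nat \<Rightarrow> 'a set set) \<Rightarrow> bool" where
  "graded G \<longleftrightarrow> (\<forall>j. finite (G j) \<and> (\<forall>S\<in>G j. card S = j))"

lemma graded_finite: "graded G \<Longrightarrow> finite (G j)"
  by (simp add: graded_def)

lemma graded_card: "\<lbrakk>graded G; S \<in> G j\<rbrakk> \<Longrightarrow> card S = j"
  by (simp add: graded_def)

lemma graded_subset_ballot: "(\<And>j. G j \<subseteq> ballot n j) \<Longrightarrow> graded G"
  unfolding graded_def by (meson ballotD finite_ballot finite_subset subsetD)

lemma graded_Union: "graded G \<Longrightarrow> (\<Union>j\<le>i. G j) = {S. S \<in> G (card S) \<and> card S \<le> i}"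
  by (auto simp: graded_def)

lemma chain_index_eq:
  "graded G \<Longrightarrow> chain_index G k = {(S, i). S \<in> G (card S) \<and> card S \<le> i \<and> i \<le> k}"
  by (auto simp: chain_index_def graded_Union)

lemma finite_chain_index: "graded G \<Longrightarrow> finite (chain_index G k)"
  by (simp add: chain_index_def graded_finite)

text \<open>The matrix is block diagonal with respect to the degree.\<close>

lemma unimodular_chain_incl:
  assumes G: "\<And>j. G j \<subseteq> ballot n j"
    and free: "\<And>i. i \<le> k \<Longrightarrow> unimodular_on (\<Union>j\<le>i. G j) (ballot n i) incl"
  shows "unimodular_on (chain_index G k) (\<Union>i\<le>k. ballot n i) chain_incl"
proof -
  have cB: "\<And>j S. S \<in> ballot n j \<Longrightarrow> card S = j"
    using ballotD by blast
  have gr: "graded G" using G by (rule graded_subset_ballot)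
  show ?thesis
  proof (rule unimodular_on_block_diagonal[where p = snd and q = card])
    show "finite (chain_index G k)" using gr by (rule finite_chain_index)
    show "finite (\<Union>i\<le>k. ballot n i)" by simp
    show "chain_incl x T = 0" if "snd x \<noteq> card T" for x :: "nat set \<times> nat" and T
      using that by (simp add: chain_incl_def)
    fix i
    show "unimodular_on {x \<in> chain_index G k. snd x = i} {T \<in> (\<Union>i\<le>k. ballot n i). card T = i}
        chain_incl"
    proof (cases "i \<le> k")
      case True
      have rows: "bij_betw fst {x \<in> chain_index G k. snd x = i} (\<Union>j\<le>i. G j)"
        by (rule bij_betw_byWitness[where f' = "\<lambda>S. (S, i)"])
           (use True in \<open>auto simp: chain_index_eq[OF gr] graded_Union[OF gr]\<close>)
      have cols: "{T \<in> (\<Union>i\<le>k. ballot n i). card T = i} = ballot n i"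
        using True cB by auto
      have "unimodular_on {x \<in> chain_index G k. snd x = i} (ballot n i) (\<lambda>x T. incl (fst x) T)"
        by (rule unimodular_on_relabel[OF free[OF True] rows bij_betw_id[unfolded id_def]])
      then show ?thesis unfolding cols
        by (rule unimodular_on_cong) (auto simp: chain_incl_def cB)
    next
      case False
      then have "{x \<in> chain_index G k. snd x = i} = {}" "{T \<in> (\<Union>i\<le>k. ballot n i). card T = i} = {}"
        using cB by (auto simp: chain_index_def)
      then show ?thesis by (simp only: unimodular_on_empty)
    qed
  qed
qed

lemma sum_incl_interval:
  assumes T: "T \<in> ballot n j" and S: "card S \<le> i"
  shows "(\<Sum>T'\<in>ballot n i. incl S T' * incl T' T)
    = ibinom (int j - int (card S)) (int i - int (card S)) * incl S T"
proof (cases "S \<subseteq> T")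
  case True
  have T': "finite T" "card T = j" "T \<subseteq> {1..n}" using ballotD[OF T] by auto
  have le: "card S \<le> j" using True T' card_mono by blast
  have eq: "{T' \<in> ballot n i. S \<subseteq> T' \<and> T' \<subseteq> T} = {X. S \<subseteq> X \<and> X \<subseteq> T \<and> card X = card S + (i - card S)}"
    using S ballot_subset[OF _ T] ballotD by auto
  have "(\<Sum>T'\<in>ballot n i. incl S T' * incl T' T)
      = (\<Sum>T'\<in>{T' \<in> ballot n i. S \<subseteq> T' \<and> T' \<subseteq> T}. 1)"
    by (rule sum.mono_neutral_cong_right) (auto simp: incl_def)
  also have "\<dots> = int ((j - card S) choose (i - card S))"
    using card_interval_subsets[OF T'(1) True, of "i - card S"] T'(2) by (simp add: eq)
  finally show ?thesis
    using True le S by (simp add: ibinom_diff incl_def)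
next
  case False
  then have "(\<Sum>T'\<in>ballot n i. incl S T' * incl T' T) = 0"
    by (intro sum.neutral) (auto simp: incl_def)
  then show ?thesis using False by (simp add: incl_def)
qed

text \<open>In the basis given by the chains, the matrix of \<open>intersection_incl_product\<close> does not mix
  different generators: summing over the sets between \<open>S\<close> and \<open>T\<close> only multiplies the inclusion of
  \<open>S\<close> in \<open>T\<close> by a number that depends on the sizes.\<close>

lemma chain_incl_product:
  assumes G: "\<And>j. G j \<subseteq> ballot n j" and k: "kr \<le> kc"
    and x: "x \<in> chain_index G kr" and T: "T \<in> (\<Union>j\<le>kc. ballot n j)"
  shows "(\<Sum>y\<in>chain_index G kc.
        (of_bool (fst x = fst y) * M_entry n kr kc l (card (fst x)) (snd x) (snd y)) * chain_incl y T)
    = (\<Sum>T'\<in>(\<Union>i\<le>kr. ballot n i).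
        chain_incl x T' * (newton_coeff n kr kc l (card T') (card T) * incl T' T))"
proof -
  obtain S i where xi: "x = (S, i)" by (cases x)
  have cB: "\<And>j S. S \<in> ballot n j \<Longrightarrow> card S = j"
    using ballotD by blast
  have gr: "graded G" using G by (rule graded_subset_ballot)
  have S: "S \<in> G (card S)" "card S \<le> i" "i \<le> kr"
    using x by (auto simp: xi chain_index_eq[OF gr])
  obtain j where j: "j \<le> kc" "T \<in> ballot n j" using T by blast
  have cT: "card T = j" using cB j by blast
  have "(\<Sum>T'\<in>(\<Union>i\<le>kr. ballot n i).
        chain_incl x T' * (newton_coeff n kr kc l (card T') (card T) * incl T' T))
      = (\<Sum>T'\<in>ballot n i. newton_coeff n kr kc l i j * (incl S T' * incl T' T))"
    by (rule sum.mono_neutral_cong_right) (use S cT cB in \<open>auto simp: xi chain_incl_def\<close>)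
  also have "\<dots> = M_entry n kr kc l (card S) i j * incl S T"
    using sum_incl_interval[OF j(2) S(2)]
    by (simp add: M_entry_newton_coeff flip: sum_distrib_left)
  also have "\<dots> = (\<Sum>y\<in>chain_index G kc.
      (of_bool (fst x = fst y) * M_entry n kr kc l (card (fst x)) (snd x) (snd y)) * chain_incl y T)"
  proof (cases "S \<subseteq> T")
    case True
    then have "card S \<le> j" using ballotD[OF j(2)] card_mono by metis
    then have y: "(S, j) \<in> chain_index G kc"
      using S j k by (simp add: chain_index_eq[OF gr])
    have "(\<Sum>y\<in>chain_index G kc.
        (of_bool (fst x = fst y) * M_entry n kr kc l (card (fst x)) (snd x) (snd y)) * chain_incl y T)
      = (\<Sum>y\<in>{(S, j)}. M_entry n kr kc l (card S) i j * incl S T)"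
      by (rule sum.mono_neutral_cong_right)
         (use y gr cT in \<open>auto simp: xi chain_incl_def intro!: finite_chain_index\<close>)
    then show ?thesis by simp
  next
    case False
    then have "(\<Sum>y\<in>chain_index G kc.
        (of_bool (fst x = fst y) * M_entry n kr kc l (card (fst x)) (snd x) (snd y)) * chain_incl y T) = 0"
      by (intro sum.neutral) (auto simp: xi chain_incl_def incl_def)
    then show ?thesis using False by (simp add: incl_def)
  qed
  finally show ?thesis by simp
qed

lemma bij_betw_chain_fibre:
  assumes "graded G" and "S \<in> G s" "s \<le> k"
  shows "bij_betw (\<lambda>x. snd x - s) {x \<in> chain_index G k. fst x = S} {..<k - s + 1}"
proof (rule bij_betw_byWitness[where f' = "\<lambda>a. (S, s + a)"])
  have "card S = s" using assms(1,2) by (rule graded_card)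
  then show "\<forall>x\<in>{x \<in> chain_index G k. fst x = S}. (S, s + (snd x - s)) = x"
      "\<forall>a\<in>{..<k - s + 1}. snd (S, s + a) - s = a"
      "(\<lambda>x. snd x - s) ` {x \<in> chain_index G k. fst x = S} \<subseteq> {..<k - s + 1}"
      "(\<lambda>a. (S, s + a)) ` {..<k - s + 1} \<subseteq> {x \<in> chain_index G k. fst x = S}"
    using assms by (auto simp: chain_index_eq[OF assms(1)])
qed

text \<open>Subtracting \<open>s\<close> from the degrees identifies the block of a generator of size \<open>s \<le> kr\<close> with
  \<open>M_mat n kr kc l s\<close>. The block of a larger generator has no rows and only adds zero columns.\<close>

lemma chain_blocks_equiv:
  assumes gr: "graded G" and k: "kr \<le> kc"
    and D: "\<And>s. s \<le> kr \<Longrightarrow> diagonal_form (M_mat n kr kc l s) (Ds s)"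
  shows "unimodular_equiv
    (chain_index G kr) (chain_index G kc)
      (\<lambda>x y. of_bool (fst x = fst y) * M_entry n kr kc l (card (fst x)) (snd x) (snd y))
    (chain_index G kr) (chain_index G kc)
      (\<lambda>x y. of_bool (x = y) * Ds (card (fst x)) $$ (snd x - card (fst x), snd x - card (fst x)))"
proof (rule unimodular_equiv_block_diagonal[where p = fst and q = fst and p' = fst and q' = fst])
  fix S :: "'a set"
  let ?A = "{x \<in> chain_index G kr. fst x = S}" and ?B = "{x \<in> chain_index G kc. fst x = S}"
  let ?s = "card S"
  show "unimodular_equiv ?A ?B
      (\<lambda>x y. of_bool (fst x = fst y) * M_entry n kr kc l (card (fst x)) (snd x) (snd y))
    ?A ?B
      (\<lambda>x y. of_bool (x = y) * Ds (card (fst x)) $$ (snd x - card (fst x), snd x - card (fst x)))"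
  proof (cases "S \<in> G ?s \<and> ?s \<le> kr")
    case True
    then have S: "S \<in> G ?s" "?s \<le> kr" "?s \<le> kc" using k by auto
    have M: "M_mat n kr kc l ?s \<in> carrier_mat (kr - ?s + 1) (kc - ?s + 1)"
      by (simp add: M_mat_def)
    note bij = bij_betw_chain_fibre[OF gr S(1,2)] bij_betw_chain_fibre[OF gr S(1,3)]
    have Ds: "dim_row (Ds ?s) = kr - ?s + 1" "dim_col (Ds ?s) = kc - ?s + 1" "diagonal_mat (Ds ?s)"
      using D[OF S(2)] M by (auto simp: diagonal_form_def)
    show ?thesis
    proof (rule unimodular_equiv_cong[OF unimodular_equiv_relabel[OF
            diagonal_form_unimodular_equiv[OF D[OF S(2)] M] bij bij]])
      fix x y assume x: "x \<in> ?A" and y: "y \<in> ?B"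
      obtain i j where xy: "x = (S, ?s + i)" "i \<le> kr - ?s" "y = (S, ?s + j)" "j \<le> kc - ?s"
      proof -
        have "x = (S, ?s + (snd x - ?s))" "snd x - ?s \<le> kr - ?s"
            "y = (S, ?s + (snd y - ?s))" "snd y - ?s \<le> kc - ?s"
          using x y by (auto simp: chain_index_eq[OF gr] prod_eq_iff intro!: diff_le_mono)
        then show thesis using that by blast
      qed
      show "M_mat n kr kc l ?s $$ (snd x - ?s, snd y - ?s)
          = of_bool (fst x = fst y) * M_entry n kr kc l (card (fst x)) (snd x) (snd y)"
        using xy by (simp add: M_mat_def)
      show "Ds ?s $$ (snd x - ?s, snd y - ?s) = of_bool (x = y)
          * Ds (card (fst x)) $$ (snd x - card (fst x), snd x - card (fst x))"
        using xy Ds by (auto simp: diagonal_mat_def)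
    qed
  next
    case False
    then have A: "?A = {}" using chain_index_eq[OF gr] by auto
    show ?thesis unfolding A
    proof (rule unimodular_equivI)
      show "unimodular_on {} {} (\<lambda>_ _. 0)" by (rule unimodular_on_empty)
      show "unimodular_on ?B ?B (\<lambda>x y. of_bool (x = y))"
        using finite_chain_index[OF gr, of kc] by (intro unimodular_on_identity) auto
    qed simp
  qed
qed (use gr in \<open>auto intro: finite_chain_index\<close>)

section \<open>Multiplicities\<close>

lemma card_Union_atMost_Suc:
  assumes "graded G"
  shows "card (\<Union>j\<le>Suc k. G j) = card (\<Union>j\<le>k. G j) + card (G (Suc k))"
proof -
  have "(\<Union>j\<le>k. G j) \<inter> G (Suc k) = {}"
    using graded_card[OF assms, of _ "Suc k"] by (force simp: graded_Union[OF assms])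
  then have "card ((\<Union>j\<le>k. G j) \<union> G (Suc k)) = card (\<Union>j\<le>k. G j) + card (G (Suc k))"
    using graded_finite[OF assms] by (intro card_Un_disjoint) auto
  then show ?thesis by (simp add: atMost_Suc Un_commute)
qed

lemma card_ballot_Suc:
  assumes "2 * Suc k \<le> n"
  shows "int (card (ballot n (Suc k))) = int (n choose Suc k) - int (n choose k)"
proof -
  have "card (\<Union>j\<le>i. ballot n j) = n choose i" if "2 * i \<le> n" for i
  proof -
    have "min i (n - i) = i" "i \<le> n" using that by auto
    then have "card (\<Union>j\<le>i. ballot n j) = card (k_subsets n i)"
      using unimodular_on_card[OF unimodular_ballot_k_subsets[of i n]] by simp
    then show ?thesis using n_subsets[of "{1..n}" i] by (simp add: k_subsets_def)
  qed
  then have "card (\<Union>j\<le>Suc k. ballot n j) = n choose Suc k" "card (\<Union>j\<le>k. ballot n j) = n choose k"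
    using assms by auto
  then show ?thesis
    using card_Union_atMost_Suc[OF graded_subset_ballot[OF order_refl], of n k] by simp
qed

text \<open>By unimodularity there are as many generators of size at most \<open>k\<close> as ballot sets of size \<open>k\<close>, and
  as many ballot sets of size at most \<open>k\<close> as \<open>k\<close>-subsets. Taking differences twice gives the second
  difference of the binomial coefficients.\<close>

lemma card_generators:
  assumes gr: "graded G"
    and free: "\<And>k. 3 * k \<le> Suc n \<Longrightarrow> unimodular_on (\<Union>j\<le>k. G j) (ballot n k) incl"
    and s: "3 * s \<le> Suc n" "s \<le> n"
  shows "int (card (G s)) = multiplicity_exponent n s"
proof -
  have step: "int (card (G (Suc k))) = int (card (ballot n (Suc k))) - int (card (ballot n k))"
    if "3 * Suc k \<le> Suc n" for k
    using unimodular_on_card[OF free[of k]] unimodular_on_card[OF free[of "Suc k"]]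
      card_Union_atMost_Suc[OF gr, of k] that by simp
  consider "s = 0" | "s = 1" | t where "s = Suc (Suc t)"
    by (metis One_nat_def not0_implies_Suc)
  then show ?thesis
  proof cases
    case 1
    then show ?thesis using unimodular_on_card[OF free[of 0]]
      by (simp add: multiplicity_exponent_def ibinom_def)
  next
    case 2
    then show ?thesis using step[of 0] card_ballot_Suc[of 0 n] s
      by (simp add: multiplicity_exponent_def ibinom_def)
  next
    case 3
    have "ibinom (int n) (int s) = int (n choose Suc (Suc t))"
        "ibinom (int n) (int s - 1) = int (n choose Suc t)" "ibinom (int n) (int s - 2) = int (n choose t)"
      using ibinom_of_nat[of n "Suc (Suc t)"] ibinom_of_nat[of n "Suc t"] ibinom_of_nat[of n t] 3
      by simp_all
    then show ?thesis
      using step[of "Suc t"] card_ballot_Suc[of "Suc t" n] card_ballot_Suc[of t n] s 3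
      by (simp add: multiplicity_exponent_def)
  qed
qed

lemma image_mset_mset_set_sum:
  "finite A \<Longrightarrow> image_mset f (mset_set A) = (\<Sum>x\<in>A. {#f x#})"
  by (induction A rule: finite_induct) auto

lemma sum_constant_mset: "finite A \<Longrightarrow> (\<Sum>x\<in>A. C) = repeat_mset (card A) C"
  by (induction A rule: finite_induct) auto

lemma diag_entries_chain_index:
  assumes gr: "graded G"
    and D: "\<And>s. s \<le> k \<Longrightarrow> min (dim_row (Ds s)) (dim_col (Ds s)) = k - s + 1"
  shows "image_mset (\<lambda>x. Ds (card (fst x)) $$ (snd x - card (fst x), snd x - card (fst x)))
      (mset_set (chain_index G k))
    = (\<Sum>s = 0..k. repeat_mset (card (G s)) (diag_entries (Ds s)))"
proof -
  have inner: "(\<Sum>i\<in>{s..k}. {#Ds s $$ (i - s, i - s)#}) = diag_entries (Ds s)" if "s \<le> k" for s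
  proof -
    have "(\<Sum>i\<in>{s..k}. {#Ds s $$ (i - s, i - s)#}) = (\<Sum>i<k - s + 1. {#Ds s $$ (i, i)#})"
      by (rule sum.reindex_bij_witness[where i = "\<lambda>a. a + s" and j = "\<lambda>i. i - s"])
         (use that in auto)
    then show ?thesis using D[OF that] by (simp add: diag_entries_def image_mset_mset_set_sum)
  qed
  have "image_mset (\<lambda>x. Ds (card (fst x)) $$ (snd x - card (fst x), snd x - card (fst x)))
      (mset_set (chain_index G k))
    = (\<Sum>x\<in>chain_index G k. {#Ds (card (fst x)) $$ (snd x - card (fst x), snd x - card (fst x))#})"
    using gr by (intro image_mset_mset_set_sum finite_chain_index)
  also have "\<dots> = (\<Sum>S\<in>(\<Union>j\<le>k. G j). \<Sum>i\<in>{card S..k}. {#Ds (card S) $$ (i - card S, i - card S)#})"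
    unfolding chain_index_def using graded_finite[OF gr] by (subst sum.Sigma) (auto simp: case_prod_beta)
  also have "\<dots> = (\<Sum>S\<in>(\<Union>j\<le>k. G j). diag_entries (Ds (card S)))"
    by (rule sum.cong) (auto simp: inner graded_card[OF gr])
  also have "\<dots> = (\<Sum>s\<le>k. \<Sum>S\<in>G s. diag_entries (Ds (card S)))"
  proof (intro sum.UNION_disjoint ballI impI)
    show "G i \<inter> G j = {}" if "i \<noteq> j" for i j
      using that graded_card[OF gr] by (metis disjoint_iff)
  qed (use graded_finite[OF gr] in auto)
  also have "\<dots> = (\<Sum>s\<le>k. repeat_mset (card (G s)) (diag_entries (Ds s)))"
    by (intro sum.cong) (simp_all add: graded_card[OF gr] graded_finite[OF gr] sum_constant_mset)
  finally show ?thesis by (simp add: atMost_atLeast0)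
qed

theorem corollary4p7:
  fixes n kr kc l :: nat
    and rs cs :: "nat set list"
    and Ds :: "nat \<Rightarrow> int mat"
  assumes "l \<le> kr" and "kr \<le> kc" and "kc \<le> n"
    and "int n \<ge> 3 * int kc - 1"
    and "enumerates rs (k_subsets n kr)"
    and "enumerates cs (k_subsets n kc)"
    and "\<And>s. s \<le> kr \<Longrightarrow> diagonal_form (M_mat n kr kc l s) (Ds s)"
  shows "\<exists>D. diagonal_form (intersection_mat rs cs l) D \<and>
    diag_entries D =
      (\<Sum>s = 0..kr. repeat_mset (nat (multiplicity_exponent n s)) (diag_entries (Ds s)))"
proof -
  have n: "3 * kc \<le> Suc n" using assms(4) by linarith
  obtain G where G: "\<And>j. G j \<subseteq> ballot n j"
    and free: "\<And>k. 3 * k \<le> Suc n \<Longrightarrow> unimodular_on (\<Union>j\<le>k. G j) (ballot n k) incl"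
    using ballot_generators[of n] by blast
  have gr: "graded G" using G by (rule graded_subset_ballot)
  have rs: "distinct rs" "set rs = k_subsets n kr" and cs: "distinct cs" "set cs = k_subsets n kc"
    using assms(5,6) by (auto simp: enumerates_def)
  let ?Ir = "chain_index G kr" and ?Ic = "chain_index G kc"
  let ?Br = "\<Union>i\<le>kr. ballot n i" and ?Bc = "\<Union>i\<le>kc. ballot n i"
  let ?d = "\<lambda>x. Ds (card (fst x)) $$ (snd x - card (fst x), snd x - card (fst x))"

  have incl: "unimodular_on (k_subsets n k) (\<Union>i\<le>k. ballot n i) (\<lambda>A T. incl T A)" if "k \<le> kc" for k
  proof -
    have "min k (n - k) = k" "k \<le> n" using that n assms(3) by auto
    then show ?thesis
      using unimodular_on_transpose[OF unimodular_ballot_k_subsets[of k n]] by simp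
  qed
  have subsets: "unimodular_equiv (k_subsets n kr) (k_subsets n kc) (\<lambda>A B. of_bool (card (A \<inter> B) = l))
      ?Br ?Bc (\<lambda>T' T. newton_coeff n kr kc l (card T') (card T) * incl T' T)"
    by (rule unimodular_equivI[OF incl incl]) (use assms(1,2) intersection_incl_product in auto)
  have chains: "unimodular_equiv ?Ir ?Ic
      (\<lambda>x y. of_bool (fst x = fst y) * M_entry n kr kc l (card (fst x)) (snd x) (snd y))
      ?Br ?Bc (\<lambda>T' T. newton_coeff n kr kc l (card T') (card T) * incl T' T)"
  proof (rule unimodular_equivI)
    show "unimodular_on ?Ir ?Br chain_incl" "unimodular_on ?Ic ?Bc chain_incl"
      using assms(2) n by (auto intro!: unimodular_chain_incl G free)
  qed (rule chain_incl_product[OF G assms(2)])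
  have "unimodular_equiv (k_subsets n kr) (k_subsets n kc)
      (\<lambda>A B. of_bool (card (A \<inter> B) = l)) ?Ir ?Ic (\<lambda>x y. of_bool (x = y) * ?d x)"
    by (rule unimodular_equiv_trans[OF unimodular_equiv_trans[OF subsets
          unimodular_equiv_sym[OF chains]] chain_blocks_equiv[OF gr assms(2,7)]])
  then have equiv: "unimodular_equiv (set rs) (set cs) (\<lambda>A B. of_bool (card (A \<inter> B) = l))
      ?Ir ?Ic (\<lambda>x y. of_bool (x = y) * ?d x)"
    by (simp only: rs cs)

  \<comment> \<open>The columns are enumerated so that they start with the enumeration \<open>xs\<close> of the rows; then the
    matching of equal labels becomes the main diagonal.\<close>
  have sub: "?Ir \<subseteq> ?Ic"
    using assms(2) by (auto simp: chain_index_eq[OF gr])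
  obtain xs where xs: "set xs = ?Ir" "distinct xs"
    using finite_distinct_list[OF finite_chain_index[OF gr, of kr]] by blast
  obtain zs where zs: "set zs = ?Ic - ?Ir" "distinct zs"
    using finite_distinct_list[OF finite_Diff[OF finite_chain_index[OF gr, of kc]]] by blast
  let ?ys = "xs @ zs"
  have ys: "set ?ys = ?Ic" "distinct ?ys" using xs zs sub by auto
  have len: "length rs = length xs" "length cs = length ?ys"
  proof -
    obtain P Q where "unimodular_on (set rs) ?Ir P" "unimodular_on (set cs) ?Ic Q"
      using equiv by (rule unimodular_equivE)
    then have "card (set rs) = card ?Ir" "card (set cs) = card ?Ic"
      by (auto dest: unimodular_on_card)
    then show "length rs = length xs" "length cs = length ?ys"
      using rs(1) cs(1) xs ys by (metis distinct_card)+
  qed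
  let ?M = "\<lambda>i j. of_bool (card (rs ! i \<inter> cs ! j) = l) :: int"
  let ?D = "\<lambda>i j. of_bool (xs ! i = ?ys ! j) * ?d (xs ! i)"
  have "unimodular_equiv {..<length rs} {..<length cs} ?M {..<length rs} {..<length cs} ?D"
    using unimodular_equiv_relabel[OF equiv bij_betw_nth[OF rs(1) refl refl]
        bij_betw_nth[OF cs(1) refl refl] bij_betw_nth[OF xs(2) refl xs(1)[symmetric]]
        bij_betw_nth[OF ys(2) refl ys(1)[symmetric]]]
    by (simp only: len)
  moreover have diag: "xs ! i = ?ys ! j \<longleftrightarrow> i = j" if "i < length rs" "j < length cs" for i j
  proof -
    have "xs ! i = ?ys ! i" using that len by (simp add: nth_append)
    then show ?thesis using that len ys(2) by (simp add: nth_eq_iff_index_eq)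
  qed
  ultimately have "diagonal_form (mat (length rs) (length cs) (\<lambda>(i, j). ?M i j))
      (mat (length rs) (length cs) (\<lambda>(i, j). ?D i j))"
    by (intro unimodular_equiv_diagonal_form) auto
  moreover have "mat (length rs) (length cs) (\<lambda>(i, j). ?M i j) = intersection_mat rs cs l"
    unfolding intersection_mat_def by (rule eq_matI) auto
  ultimately have "diagonal_form (intersection_mat rs cs l)
      (mat (length rs) (length cs) (\<lambda>(i, j). ?D i j))"
    by (simp only:)
  moreover have "diag_entries (mat (length rs) (length cs) (\<lambda>(i, j). ?D i j))
      = (\<Sum>s = 0..kr. repeat_mset (nat (multiplicity_exponent n s)) (diag_entries (Ds s)))"
  proof -
    have min: "min (length rs) (length cs) = length xs" using len by simp
    have "diag_entries (mat (length rs) (length cs) (\<lambda>(i, j). ?D i j))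
        = image_mset (\<lambda>i. ?d (xs ! i)) (mset_set {..<length xs})"
      unfolding diag_entries_def dim_row_mat dim_col_mat min
      by (rule image_mset_cong) (use len diag in auto)
    also have "\<dots> = image_mset ?d (image_mset ((!) xs) (mset_set {..<length xs}))"
      by (simp only: multiset.map_comp comp_def)
    also have "image_mset ((!) xs) (mset_set {..<length xs}) = mset xs"
      using mset_map[of "(!) xs" "[0..<length xs]"] by (simp only: map_nth mset_upt lessThan_atLeast0)
    also have "mset xs = mset_set ?Ir"
      using mset_set_set[OF xs(2)] xs(1) by simp
    also have "image_mset ?d (mset_set ?Ir)
        = (\<Sum>s = 0..kr. repeat_mset (card (G s)) (diag_entries (Ds s)))"
    proof (rule diag_entries_chain_index[OF gr])
      show "min (dim_row (Ds s)) (dim_col (Ds s)) = kr - s + 1" if "s \<le> kr" for s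
        using assms(7)[OF that] assms(2) by (auto simp: diagonal_form_def M_mat_def)
    qed
    also have "\<dots> = (\<Sum>s = 0..kr. repeat_mset (nat (multiplicity_exponent n s)) (diag_entries (Ds s)))"
    proof (rule sum.cong)
      fix s assume "s \<in> {0..kr}"
      then have "int (card (G s)) = multiplicity_exponent n s"
        using n assms(2,3) by (intro card_generators[OF gr free]) auto
      then show "repeat_mset (card (G s)) (diag_entries (Ds s))
          = repeat_mset (nat (multiplicity_exponent n s)) (diag_entries (Ds s))"
        by (metis nat_int)
    qed simp
    finally show ?thesis .
  qed
  ultimately show ?thesis by (intro exI conjI)
qed

end
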